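(* Let $(a,b,c,d)$ be any integers, put $g=\gcd(a+b,a+c)$ and $\Sigma=a+b+c+d$, and let $B_1=\{\bot,\top\}$ be the two-element Boolean algebra, with its four-term chain complex for the scalars $(a,b,c,d)$. Then for every $n\ge 0$ $$ H_n(B_1,\bot)\cong\begin{cases} \mathbb Z^{2^{n+1}-1}, & \Sigma=0,\ g=0,\\ \mathbb Z_g^{2r_n-p(n+1)}, & \Sigma=0,\ g\neq 0,\\ \mathbb Z^{2^n}\oplus\mathbb Z_\Sigma^{r_n-p(n+1)}, & \Sigma\neq 0,\ g=0,\\ \mathbb Z_g^{r_n}\oplus\mathbb Z_{\gcd(g,\Sigma)}^{r_n-p(n+1)}, & \Sigma\neq 0,\ g\neq 0, \end{cases} $$ where $p(n)\in\{0,1\}$ is the parity of $n$ ($p(n)=1$ iff $n$ is odd) and $r_n=\frac13(2^{n+1}+1)$ for $n$ even, $r_n=\frac13(2^{n+1}-1)$ for $n$ odd.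
   Context: On a lattice $L$ consider four binary operations: $x\vdash y:=x$, $x\lor y$ (join), $x\land y$ (meet), $x\dashv y:=y$. The four-term chain complex $C(L)$ with integer scalars $(a,b,c,d)$ has $C_n(L)=\mathbb Z L^{n+1}$ for $n\ge 0$, $C_n(L)=0$ for $n<0$, and differential $\partial = a\,\partial^{\vdash}+b\,\partial^{\lor}+c\,\partial^{\land}+d\,\partial^{\dashv}$, where for a binary operation $\star$: $\partial^\star_n=\sum_{i=0}^n(-1)^i d_i^\star$ for $n\ge1$ (and $\partial_0=0$), with $d_0^\star(x_0,\dots,x_n)=(x_1,\dots,x_n)$ and $d_i^\star(x_0,\dots,x_n)=(x_0\star x_i,\dots,x_{i-1}\star x_i,x_{i+1},\dots,x_n)$ for $i\ge 1$. For $t\in L$, $C(\{t\})\subset C(L)$ is the subcomplex spanned by the tuples $(t,\dots,t)$, $C(L,t):=C(L)/C(\{t\})$, and $H_n(L,t)$ is its homology. $\mathbb Z_m=\mathbb Z/m\mathbb Z$. *)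

theory Defs
  imports "HOL-Algebra.Free_Abelian_Groups" "HOL-Algebra.Product_Groups"
    "HOL-Algebra.Elementary_Groups"
begin

text \<open>
  Tuples are lists: an \<open>n\<close>-chain is a formal \<open>\<int>\<close>-combination of lists of length \<open>n + 1\<close>.  Degrees
  are integers; the condition \<open>xs \<noteq> []\<close> makes the chain groups in negative degrees trivial, in
  particular in degree \<open>- 1\<close>.
\<close>

definition tuples :: "'a set \<Rightarrow> int \<Rightarrow> 'a list set" where
  "tuples S n = {xs. xs \<noteq> [] \<and> set xs \<subseteq> S \<and> int (length xs) = n + 1}"

text \<open>\<open>chain_group UNIV n\<close> is \<open>C\<^sub>n(L)\<close>, and \<open>chain_group {t} n\<close> is \<open>C\<^sub>n({t})\<close> inside it.\<close>

definition chain_group :: "'a set \<Rightarrow> int \<Rightarrow> ('a list \<Rightarrow>\<^sub>0 int) monoid" where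
  "chain_group S n = free_Abelian_group (tuples S n)"

text \<open>For \<open>i = 0\<close> the first part is empty and this is \<open>(x\<^sub>1, \<dots>, x\<^sub>n)\<close>, as it should be.\<close>

definition face :: "('a \<Rightarrow> 'a \<Rightarrow> 'a) \<Rightarrow> nat \<Rightarrow> 'a list \<Rightarrow> 'a list" where
  "face f i xs = map (\<lambda>x. f x (xs ! i)) (take i xs) @ drop (Suc i) xs"

text \<open>The degree is implicit in the length of the tuples; the case distinction says \<open>\<partial>\<^sub>0 = 0\<close>.\<close>

definition op_boundary :: "('a \<Rightarrow> 'a \<Rightarrow> 'a) \<Rightarrow> ('a list \<Rightarrow>\<^sub>0 int) \<Rightarrow> ('a list \<Rightarrow>\<^sub>0 int)" where
  "op_boundary f = frag_extend (\<lambda>xs. if length xs \<le> 1 then 0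
     else (\<Sum>i<length xs. frag_cmul ((-1) ^ i) (frag_of (face f i xs))))"

definition boundary ::
    "int \<Rightarrow> int \<Rightarrow> int \<Rightarrow> int \<Rightarrow> ('a::lattice list \<Rightarrow>\<^sub>0 int) \<Rightarrow> ('a list \<Rightarrow>\<^sub>0 int)" where
  "boundary a b c d u =
     frag_cmul a (op_boundary (\<lambda>x y. x) u) + frag_cmul b (op_boundary sup u) +
     frag_cmul c (op_boundary inf u) + frag_cmul d (op_boundary (\<lambda>x y. y) u)"

definition rel_chain_group :: "'a \<Rightarrow> int \<Rightarrow> ('a list \<Rightarrow>\<^sub>0 int) set monoid" where
  "rel_chain_group t n = chain_group UNIV n Mod carrier (chain_group {t} n)"

text \<open>
  The differential induced on the quotient: the coset of \<open>u\<close> is sent to the coset of \<open>\<partial> u\<close>, i.e.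
  to \<open>C({t}) + \<partial>(u + C({t}))\<close>, because \<open>C({t})\<close> is a subcomplex.
\<close>

definition rel_boundary ::
    "int \<Rightarrow> int \<Rightarrow> int \<Rightarrow> int \<Rightarrow> 'a::lattice \<Rightarrow> int \<Rightarrow> ('a list \<Rightarrow>\<^sub>0 int) set \<Rightarrow> ('a list \<Rightarrow>\<^sub>0 int) set"
  where
  "rel_boundary a b c d t n A =
     carrier (chain_group {t} (n - 1)) <#>\<^bsub>chain_group UNIV (n - 1)\<^esub> (boundary a b c d ` A)"

definition rel_homology_group ::
    "int \<Rightarrow> int \<Rightarrow> int \<Rightarrow> int \<Rightarrow> 'a::lattice \<Rightarrow> int \<Rightarrow> ('a list \<Rightarrow>\<^sub>0 int) set set monoid" where
  "rel_homology_group a b c d t n =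
     subgroup_generated (rel_chain_group t n)
       (kernel (rel_chain_group t n) (rel_chain_group t (n - 1)) (rel_boundary a b c d t n))
     Mod (rel_boundary a b c d t (n + 1) ` carrier (rel_chain_group t (n + 1)))"

text \<open>\<open>\<int>\<^sub>m\<close> depends only on \<open>\<bar>m\<bar>\<close>; \<open>\<int>\<^sub>0\<close> is \<open>\<int>\<close> and \<open>\<int>\<^sub>1\<close> is trivial.\<close>

definition Zmod :: "int \<Rightarrow> int monoid" where
  "Zmod m = integer_mod_group (nat \<bar>m\<bar>)"

definition group_power :: "'b monoid \<Rightarrow> nat \<Rightarrow> (nat \<Rightarrow> 'b) monoid" where
  "group_power G k = product_group {..<k} (\<lambda>_. G)"

definition parity :: "nat \<Rightarrow> nat" where
  "parity n = (if odd n then 1 else 0)"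

text \<open>Both divisions by \<open>3\<close> are exact.\<close>

definition r_seq :: "nat \<Rightarrow> nat" where
  "r_seq n = (if even n then (2 ^ (n + 1) + 1) div 3 else (2 ^ (n + 1) - 1) div 3)"

end

theory Submission
  imports Defs
begin

text \<open>
  For \<open>L = {\<bottom>, \<top>}\<close> the faces are simple: on the prefix before an entry \<open>x = \<bottom>\<close>, join acts like
  \<open>\<turnstile>\<close> and meet like \<open>\<stileturn>\<close>; for \<open>x = \<top>\<close> the two roles are exchanged.  So the \<open>i\<close>-th face of the combined
  differential is \<open>weight x\<^sub>i\<close> times the deletion of \<open>x\<^sub>i\<close> plus \<open>\<Sigma> - weight x\<^sub>i\<close> times the tuple whose
  prefix has been made constantly \<open>x\<^sub>i\<close>, where \<open>weight \<bottom> = a + b\<close> and \<open>weight \<top> = a + c\<close>.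

  The relative complex is isomorphic to the kernel of the augmentation, by \<open>w \<mapsto> w - (\<bottom>, \<dots>, \<bottom>)\<close>.  On
  chains of augmentation zero the constant tuples cancel in the last face, and appending a letter
  becomes a signed derivation: \<open>\<partial>(wx) = \<partial>(w) x + (-1)\<^sup>\<bar>\<^sup>w\<^sup>\<bar> weight(x) w\<close>.  Hence the relative complex is a
  tensor product \<open>U \<otimes> T(V)\<close>.  Here \<open>U\<close> has one generator \<open>u\<^sub>k = (\<top>, \<dots>, \<top>) - (\<bottom>, \<dots>, \<bottom>)\<close> in each degree
  \<open>k\<close>, with \<open>\<partial> u\<^sub>k = \<Sigma> u\<^bsub>k-1\<^esub>\<close> for even \<open>k > 0\<close> and \<open>\<partial> u\<^sub>k = 0\<close> otherwise, and \<open>T(V)\<close> is the tensor algebra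
  of \<open>V = \<int>\<bottom> \<oplus> \<int>\<top>\<close> whose differential is the derivation extending \<open>weight : V \<rightarrow> \<int>\<close>.

  Since \<open>g = gcd (a + b) (a + c)\<close>, the lattice \<open>V\<close> has a basis \<open>s, t\<close> of weights \<open>g\<close> and \<open>0\<close>.  The
  differential of \<open>T(V)\<close> is \<open>g\<close> times an exact differential; the cycles of the latter form the free
  algebra on \<open>t\<close>, \<open>ss\<close> and \<open>st + ts\<close>, and \<open>T(V)\<close> is the direct sum of these cycles and their
  right multiples by \<open>s\<close>.  So the relative complex splits, over all words \<open>v\<close> in \<open>t, ss, st + ts\<close>,
  into shifted copies of one small complex: \<open>U\<close> tensored with \<open>\<int>s \<rightarrow> \<int>\<close>, the map being multiplication by
  \<open>\<plusminus>g\<close>.  In each degree the small complex has rank at most two, and its homology is read off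
  by hand: \<open>\<int>\<^sub>g\<close> in degree \<open>0\<close> and \<open>\<int>\<close> modulo \<open>gcd g \<Sigma>\<close> in every positive degree, with one more \<open>\<int>\<close> in
  degree \<open>1\<close> if \<open>g = 0 \<noteq> \<Sigma>\<close>; if \<open>g = \<Sigma> = 0\<close> the differential vanishes.  The theorem follows because the
  number \<open>r\<^sub>n\<close> of words of degree \<open>n\<close> satisfies \<open>r\<^bsub>n+2\<^esub> = r\<^bsub>n+1\<^esub> + 2 r\<^sub>n\<close>, which gives \<open>r_seq n\<close>, and the
  number of words of smaller degree is \<open>r_seq n - parity (n + 1)\<close>.

  The splitting is proved by the mutually inverse maps \<open>to_model\<close> and \<open>from_model\<close>; the first is a chain
  map by \<open>to_model_boundary\<close>.  The homology of the split complex is \<open>rel_homology_nonzero\<close> and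
  \<open>rel_homology_all_zero\<close>.
\<close>

section \<open>Products of cyclic groups\<close>

lemma Zmod_simps [simp]:
  "x \<otimes>\<^bsub>Zmod m\<^esub> y = (x + y) mod \<bar>m\<bar>" "\<one>\<^bsub>Zmod m\<^esub> = 0" "group (Zmod m)"
  by (simp_all add: Zmod_def)

lemma carrier_Zmod: "carrier (Zmod m) = range (\<lambda>z. z mod \<bar>m\<bar>)"
proof (cases "m = 0")
  case False
  then have "x \<in> range (\<lambda>z. z mod \<bar>m\<bar>)" if "0 \<le> x" "x < \<bar>m\<bar>" for x
    using that by (intro range_eqI[of _ _ x]) simp
  with False show ?thesis
    by (auto simp: Zmod_def carrier_integer_mod_group)
qed (auto simp: Zmod_def carrier_integer_mod_group)

text \<open>
  Homology is computed by exhibiting integer coordinates on the cycles that take all values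
  independently and that recognise boundaries by divisibility.
\<close>

lemma quotient_iso_product_Zmod:
  assumes G: "group G"
    and hom: "\<And>j x y. j \<in> J \<Longrightarrow> x \<in> carrier G \<Longrightarrow> y \<in> carrier G \<Longrightarrow>
      \<phi> j (x \<otimes>\<^bsub>G\<^esub> y) = \<phi> j x + \<phi> j y"
    and surj: "\<And>f :: 'j \<Rightarrow> int. \<exists>x\<in>carrier G. \<forall>j\<in>J. \<phi> j x = f j"
    and N: "N \<subseteq> carrier G"
    and N_iff: "\<And>x. x \<in> carrier G \<Longrightarrow> x \<in> N \<longleftrightarrow> (\<forall>j\<in>J. m j dvd \<phi> j x)"
  shows "G Mod N \<cong> product_group J (\<lambda>j. Zmod (m j))" (is "_ \<cong> ?P")
proof -
  define h where "h x = (\<lambda>j\<in>J. \<phi> j x mod \<bar>m j\<bar>)" for x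
  have h: "h \<in> hom G ?P"
    by (auto intro!: homI simp: h_def carrier_Zmod hom mod_add_eq fun_eq_iff restrict_def)
  interpret group_hom G ?P h
    using G h by (simp add: group_hom_def group_hom_axioms_def)
  have "h x = \<one>\<^bsub>?P\<^esub> \<longleftrightarrow> (\<forall>j\<in>J. m j dvd \<phi> j x)" for x
  proof -
    have "z mod \<bar>m j\<bar> = 0 \<longleftrightarrow> m j dvd z" for z j
      by (simp add: mod_eq_0_iff_dvd)
    then show ?thesis by (auto simp: h_def fun_eq_iff restrict_def)
  qed
  then have "kernel G ?P h = N"
    using N N_iff unfolding kernel_def by blast
  moreover have "h ` carrier G = carrier ?P"
  proof
    show "h ` carrier G \<subseteq> carrier ?P"
      using h by (auto simp: hom_def)
    show "carrier ?P \<subseteq> h ` carrier G"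
    proof
      fix f assume f: "f \<in> carrier ?P"
      obtain x where x: "x \<in> carrier G" "\<forall>j\<in>J. \<phi> j x = f j"
        using surj by blast
      have "f j mod \<bar>m j\<bar> = f j" if "j \<in> J" for j
        using f that by (auto simp: carrier_Zmod PiE_iff)
      then have "h x = f"
        using f x(2) by (auto simp: h_def fun_eq_iff PiE_iff extensional_def)
      with x(1) show "f \<in> h ` carrier G" by blast
    qed
  qed
  ultimately show ?thesis using FactGroup_iso by simp
qed

lemma product_group_iso_power:
  assumes "finite J"
  shows "product_group J (\<lambda>_. A) \<cong> group_power A (card J)" (is "?P \<cong> ?Q")
proof -
  obtain f where f: "bij_betw f {..<card J} J"
    using ex_bij_betw_nat_finite[OF assms] by (auto simp: atLeast0LessThan)
  define F where "F x = (\<lambda>i\<in>{..<card J}. x (f i))" for x :: "'a \<Rightarrow> 'b"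
  define F' where "F' y = (\<lambda>j\<in>J. y (inv_into {..<card J} f j))" for y :: "nat \<Rightarrow> 'b"
  have f_in: "f i \<in> J" if "i < card J" for i
    using bij_betw_apply[OF f] that by simp
  have inv_in: "inv_into {..<card J} f j < card J" if "j \<in> J" for j
    using bij_betw_apply[OF bij_betw_inv_into[OF f] that] by simp
  have "F \<in> hom ?P ?Q"
  proof (rule homI)
    show "F x \<in> carrier ?Q" if "x \<in> carrier ?P" for x
      using that f_in by (simp add: group_power_def F_def PiE_iff)
    show "F (x \<otimes>\<^bsub>?P\<^esub> y) = F x \<otimes>\<^bsub>?Q\<^esub> F y" for x y
      using f_in by (simp add: group_power_def F_def cong: restrict_cong)
  qed
  moreover have "bij_betw F (carrier ?P) (carrier ?Q)"
  proof (rule bij_betw_byWitness[where f' = F'])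
    show "\<forall>x\<in>carrier ?P. F' (F x) = x"
    proof
      fix x assume x: "x \<in> carrier ?P"
      have "F' (F x) j = x j" for j
        using x bij_betw_inv_into_right[OF f, of j] inv_in[of j]
        by (cases "j \<in> J") (auto simp: F_def F'_def PiE_iff extensional_def)
      then show "F' (F x) = x" by blast
    qed
    show "\<forall>y\<in>carrier ?Q. F (F' y) = y"
    proof
      fix y assume y: "y \<in> carrier ?Q"
      have "F (F' y) i = y i" for i
        using y bij_betw_inv_into_left[OF f, of i] f_in[of i]
        by (cases "i < card J") (auto simp: group_power_def F_def F'_def PiE_iff extensional_def)
      then show "F (F' y) = y" by blast
    qed
  next
    show "F ` carrier ?P \<subseteq> carrier ?Q"
      using f_in by (simp add: group_power_def F_def PiE_iff image_subset_iff)
    show "F' ` carrier ?Q \<subseteq> carrier ?P"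
      using inv_in by (simp add: group_power_def F'_def PiE_iff image_subset_iff)
  qed
  ultimately show ?thesis unfolding is_iso_def iso_def by blast
qed

lemma product_group_Un_iso:
  assumes "J \<inter> K = {}"
  shows "product_group (J \<union> K) A \<cong> product_group J A \<times>\<times> product_group K A" (is "?P \<cong> ?Q")
proof -
  define F where "F x = (restrict x J, restrict x K)" for x :: "'a \<Rightarrow> 'b"
  define F' where "F' y = (\<lambda>j\<in>J \<union> K. if j \<in> J then fst y j else snd y j)"
    for y :: "('a \<Rightarrow> 'b) \<times> ('a \<Rightarrow> 'b)"
  have "F \<in> hom ?P ?Q"
    by (auto intro!: homI simp: F_def fun_eq_iff restrict_def PiE_iff extensional_def)
  moreover have "bij_betw F (carrier ?P) (carrier ?Q)"
    using assms
    by (intro bij_betw_byWitness[where f' = F'])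
      (auto simp: F_def F'_def fun_eq_iff PiE_iff extensional_def)
  ultimately show ?thesis unfolding is_iso_def iso_def by blast
qed

lemma product_group_cong:
  assumes "\<And>j. j \<in> J \<Longrightarrow> A j = B j"
  shows "product_group J A = product_group J B"
  using assms by (auto simp: product_group_def fun_eq_iff restrict_def cong: PiE_cong)

section \<open>The split model complex\<close>

text \<open>
  All maps below are additive, so identities between them are checked on generators.
\<close>

lemma frag_linear_eq:
  fixes F G :: "('a \<Rightarrow>\<^sub>0 int) \<Rightarrow> ('b \<Rightarrow>\<^sub>0 int)"
  assumes "\<And>x y. F (x - y) = F x - F y" and "\<And>x y. G (x - y) = G x - G y"
    and "\<And>i. i \<in> Poly_Mapping.keys u \<Longrightarrow> F (frag_of i) = G (frag_of i)"
  shows "F u = G u"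
proof -
  have F0: "F 0 = 0" using assms(1)[of 0 0] by simp
  have G0: "G 0 = 0" using assms(2)[of 0 0] by simp
  show ?thesis
    using subset_refl[of "Poly_Mapping.keys u"]
    by (induction u rule: frag_induction) (simp_all add: F0 G0 assms)
qed

lemmas frag_lookup = lookup_add lookup_minus

text \<open>
  The letters stand for the generators \<open>t\<close>, \<open>ss\<close> and \<open>st + ts\<close> of the cycle algebra.  A cell \<open>(k, v, e)\<close> stands
  for \<open>u\<^sub>k \<otimes> v\<close>, times \<open>s\<close> on the right if \<open>e\<close> holds.  Tuples grow at their right end, so the word \<open>v\<close> is
  stored in reverse order, with its last letter at the head.
\<close>

datatype cycle_letter = T | SS | ST

type_synonym cell = "nat \<times> cycle_letter list \<times> bool"

fun letter_degree :: "cycle_letter \<Rightarrow> nat" where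
  "letter_degree T = 1" | "letter_degree SS = 2" | "letter_degree ST = 2"

definition word_degree :: "cycle_letter list \<Rightarrow> nat" where
  "word_degree v = sum_list (map letter_degree v)"

lemma word_degree_simps [simp]:
  "word_degree [] = 0" "word_degree (l # v) = letter_degree l + word_degree v"
  by (simp_all add: word_degree_def)

fun cell_degree :: "cell \<Rightarrow> nat" where
  "cell_degree (k, v, e) = k + word_degree v + (if e then 1 else 0)"

text \<open>
  Right multiplication by \<open>s\<close> and \<open>t\<close>, in terms of cells: \<open>(x s) s = x (ss)\<close> and
  \<open>(x s) t = x (st + ts) - (x t) s\<close>.
\<close>

definition mul_s :: "(cell \<Rightarrow>\<^sub>0 int) \<Rightarrow> (cell \<Rightarrow>\<^sub>0 int)" where
  "mul_s = frag_extend (\<lambda>(k, v, e). if e then frag_of (k, SS # v, False) else frag_of (k, v, True))"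

definition mul_t :: "(cell \<Rightarrow>\<^sub>0 int) \<Rightarrow> (cell \<Rightarrow>\<^sub>0 int)" where
  "mul_t = frag_extend (\<lambda>(k, v, e). if e then frag_of (k, ST # v, False) - frag_of (k, T # v, True)
     else frag_of (k, T # v, False))"

text \<open>
  The image of \<open>(\<top>, \<dots>, \<top>)\<close> in the model.  The argument is the length of the tuple, one more than its degree,
  and the empty tuple has image \<open>0\<close>.
\<close>

fun top_cell :: "nat \<Rightarrow> (cell \<Rightarrow>\<^sub>0 int)" where
  "top_cell 0 = 0" | "top_cell (Suc k) = frag_of (k, [], False)"

lemma mul_diff [simp]: "mul_s (x - y) = mul_s x - mul_s y" "mul_t (x - y) = mul_t x - mul_t y"
  by (simp_all add: mul_s_def mul_t_def frag_extend_diff)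

lemma mul_cmul [simp]: "mul_s (frag_cmul r x) = frag_cmul r (mul_s x)"
  "mul_t (frag_cmul r x) = frag_cmul r (mul_t x)"
  by (simp_all add: mul_s_def mul_t_def frag_extend_cmul)

lemma mul_add [simp]: "mul_s (x + y) = mul_s x + mul_s y" "mul_t (x + y) = mul_t x + mul_t y"
  by (simp_all add: mul_s_def mul_t_def frag_extend_add)

lemma mul_0 [simp]: "mul_s 0 = 0" "mul_t 0 = 0"
  by (simp_all add: mul_s_def mul_t_def)

lemma mul_st_simps [simp]:
  "mul_s (frag_of (k, v, False)) = frag_of (k, v, True)"
  "mul_s (frag_of (k, v, True)) = frag_of (k, SS # v, False)"
  "mul_t (frag_of (k, v, False)) = frag_of (k, T # v, False)"
  "mul_t (frag_of (k, v, True)) = frag_of (k, ST # v, False) - frag_of (k, T # v, True)"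
  by (simp_all add: mul_s_def mul_t_def)

lemma keys_mul_s: "Poly_Mapping.keys m \<subseteq> {x. cell_degree x = n} \<Longrightarrow>
    Poly_Mapping.keys (mul_s m) \<subseteq> {x. cell_degree x = Suc n}"
  unfolding mul_s_def by (rule order_trans[OF keys_frag_extend]) (fastforce split: if_splits)

lemma keys_mul_t: "Poly_Mapping.keys m \<subseteq> {x. cell_degree x = n} \<Longrightarrow>
    Poly_Mapping.keys (mul_t m) \<subseteq> {x. cell_degree x = Suc n}"
  unfolding mul_t_def
  by (rule order_trans[OF keys_frag_extend])
    (fastforce split: if_splits dest: subsetD[OF keys_diff])

text \<open>
  The integers \<open>\<alpha>, \<beta>, p, q\<close> give the change of basis of \<open>V\<close>: \<open>s = p \<bottom> + q \<top>\<close> and \<open>t = \<alpha> \<top> - \<beta> \<bottom>\<close>.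
\<close>

locale four_term_scalars =
  fixes a b c d g \<alpha> \<beta> p q :: int
  assumes ab: "a + b = g * \<alpha>" and ac: "a + c = g * \<beta>" and unimodular: "p * \<alpha> + q * \<beta> = 1"
begin

definition total :: int where "total = a + b + c + d"

text \<open>
  By the assumptions of the locale this is \<open>a + c\<close> for \<open>\<top>\<close> and \<open>a + b\<close> for \<open>\<bottom>\<close>.
\<close>

definition weight :: "bool \<Rightarrow> int" where "weight x = g * (if x then \<beta> else \<alpha>)"

text \<open>
  The first summand is the differential of \<open>U\<close>.  As \<open>v\<close> is a cycle, the derivation on \<open>T(V)\<close> only removes a
  final \<open>s\<close>, with factor \<open>g\<close>; the sign is that of its position.
\<close>

definition model_boundary :: "(cell \<Rightarrow>\<^sub>0 int) \<Rightarrow> (cell \<Rightarrow>\<^sub>0 int)" where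
  "model_boundary = frag_extend (\<lambda>(k, v, e).
     (if even k \<and> k > 0 then frag_cmul total (frag_of (k - 1, v, e)) else 0) +
     (if e then frag_cmul ((-1) ^ (k + word_degree v + 1) * g) (frag_of (k, v, False)) else 0))"

text \<open>
  Right multiplication by a letter of the original alphabet, by the inverse change of basis
  \<open>\<bottom> = \<alpha> s - q t\<close> and \<open>\<top> = \<beta> s + p t\<close>.
\<close>

definition mul :: "bool \<Rightarrow> (cell \<Rightarrow>\<^sub>0 int) \<Rightarrow> (cell \<Rightarrow>\<^sub>0 int)" where
  "mul x m = (if x then frag_cmul \<beta> (mul_s m) + frag_cmul p (mul_t m)
              else frag_cmul \<alpha> (mul_s m) - frag_cmul q (mul_t m))"

lemma model_boundary_diff [simp]:
  "model_boundary (x - y) = model_boundary x - model_boundary y"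
  and model_boundary_add [simp]: "model_boundary (x + y) = model_boundary x + model_boundary y"
  and model_boundary_cmul [simp]: "model_boundary (frag_cmul r x) = frag_cmul r (model_boundary x)"
  and model_boundary_0 [simp]: "model_boundary 0 = 0"
  by (simp_all add: model_boundary_def frag_extend_diff frag_extend_add frag_extend_cmul)

lemma model_boundary_of:
  "model_boundary (frag_of (k, v, e)) =
     (if even k \<and> k > 0 then frag_cmul total (frag_of (k - 1, v, e)) else 0) +
     (if e then frag_cmul ((-1) ^ (k + word_degree v + 1) * g) (frag_of (k, v, False)) else 0)"
  by (simp add: model_boundary_def)

lemma mul_linear [simp]:
  "mul x (y - z) = mul x y - mul x z" "mul x (y + z) = mul x y + mul x z"
  "mul x (frag_cmul r y) = frag_cmul r (mul x y)" "mul x 0 = 0"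
  unfolding mul_def
  by (auto intro!: poly_mapping_eqI simp: frag_lookup algebra_simps)

text \<open>
  The Leibniz rules below say that the boundary formula on cells is the signed derivation on \<open>U \<otimes> T(V)\<close>
  determined by the weights \<open>g\<close> of \<open>s\<close> and \<open>0\<close> of \<open>t\<close>.
\<close>

lemma model_boundary_mul_s:
  assumes "Poly_Mapping.keys m \<subseteq> {x. cell_degree x = n}"
  shows "model_boundary (mul_s m) = mul_s (model_boundary m) + frag_cmul ((-1) ^ (n + 1) * g) m"
proof (rule frag_linear_eq[where F = "\<lambda>m. model_boundary (mul_s m)"
        and G = "\<lambda>m. mul_s (model_boundary m) + frag_cmul ((-1) ^ (n + 1) * g) m"])
  fix i assume "i \<in> Poly_Mapping.keys m"
  with assms have i: "cell_degree i = n" by auto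
  obtain k v e where "i = (k, v, e)" by (cases i)
  with i show "model_boundary (mul_s (frag_of i)) =
      mul_s (model_boundary (frag_of i)) + frag_cmul ((-1) ^ (n + 1) * g) (frag_of i)"
    by (cases e) (auto intro!: poly_mapping_eqI simp: model_boundary_of frag_lookup)
qed (auto intro!: poly_mapping_eqI simp: frag_lookup algebra_simps)

lemma model_boundary_mul_t: "model_boundary (mul_t m) = mul_t (model_boundary m)"
proof (rule frag_linear_eq[where F = "\<lambda>m. model_boundary (mul_t m)"
        and G = "\<lambda>m. mul_t (model_boundary m)"])
  fix i :: cell
  obtain k v e where "i = (k, v, e)" by (cases i)
  then show "model_boundary (mul_t (frag_of i)) = mul_t (model_boundary (frag_of i))"
    by (cases e) (auto intro!: poly_mapping_eqI simp: model_boundary_of frag_lookup)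
qed auto

lemma model_boundary_mul:
  assumes "Poly_Mapping.keys m \<subseteq> {x. cell_degree x = n}"
  shows "model_boundary (mul x m) =
    mul x (model_boundary m) + frag_cmul ((-1) ^ (n + 1) * weight x) m"
  by (auto intro!: poly_mapping_eqI simp: mul_def weight_def frag_lookup algebra_simps
      model_boundary_mul_s[OF assms] model_boundary_mul_t)

lemma keys_mul: "Poly_Mapping.keys m \<subseteq> {x. cell_degree x = n} \<Longrightarrow>
    Poly_Mapping.keys (mul x m) \<subseteq> {x. cell_degree x = Suc n}"
  using keys_mul_s[of m n] keys_mul_t[of m n] keys_cmul
  by (auto simp: mul_def dest!: subsetD[OF keys_diff] subsetD[OF keys_add])

section \<open>From tuples to the model\<close>

text \<open>
  In the kernel of the augmentation, the class of \<open>w\<bottom>\<close> is the class of \<open>w\<close> times \<open>\<bottom>\<close>, while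
  \<open>w\<top> - (\<bottom>, \<dots>, \<bottom>, \<bottom>)\<close> is \<open>(w - (\<bottom>, \<dots>, \<bottom>)) \<top> + (\<bottom>, \<dots>, \<bottom>, \<top>) - (\<bottom>, \<dots>, \<bottom>, \<bottom>)\<close>; its second part is
  \<open>u\<^sub>n - u\<^bsub>n-1\<^esub> \<top>\<close>, with \<open>n\<close> the length of \<open>w\<close>.  The recursion runs over the reversed tuple.
\<close>

primrec to_model_rev :: "bool list \<Rightarrow> (cell \<Rightarrow>\<^sub>0 int)" where
  "to_model_rev [] = 0"
| "to_model_rev (x # w) = mul x (to_model_rev w) +
     (if x then top_cell (Suc (length w)) - mul True (top_cell (length w)) else 0)"

definition to_model :: "(bool list \<Rightarrow>\<^sub>0 int) \<Rightarrow> (cell \<Rightarrow>\<^sub>0 int)" where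
  "to_model = frag_extend (\<lambda>w. to_model_rev (rev w))"

lemma to_model_linear [simp]:
  "to_model (x - y) = to_model x - to_model y" "to_model (x + y) = to_model x + to_model y"
  "to_model (frag_cmul r x) = frag_cmul r (to_model x)" "to_model 0 = 0"
  by (simp_all add: to_model_def frag_extend_diff frag_extend_add frag_extend_cmul)

lemma to_model_Nil [simp]: "to_model (frag_of []) = 0"
  by (simp add: to_model_def)

lemma to_model_snoc: "to_model (frag_of (w @ [x])) = mul x (to_model (frag_of w)) +
     (if x then top_cell (Suc (length w)) - mul True (top_cell (length w)) else 0)"
  by (simp add: to_model_def)

lemma to_model_False [simp]: "to_model (frag_of (replicate n False)) = 0"
  by (induction n) (simp_all add: replicate_append_same[symmetric] to_model_snoc)

lemma to_model_True [simp]: "to_model (frag_of (replicate n True)) = top_cell n"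
  by (induction n) (simp_all add: replicate_append_same[symmetric] to_model_snoc)

lemma keys_top_cell: "Poly_Mapping.keys (top_cell n) \<subseteq> {x. Suc (cell_degree x) = n}"
  by (cases n) auto

lemma keys_to_model_of:
  "Poly_Mapping.keys (to_model (frag_of w)) \<subseteq> {x. Suc (cell_degree x) = length w}"
proof (induction w rule: rev_induct)
  case (snoc x w)
  have mulx: "Poly_Mapping.keys (mul x m) \<subseteq> {x. cell_degree x = length w}"
    if "Poly_Mapping.keys m \<subseteq> {x. Suc (cell_degree x) = length w}" for m x
  proof (cases "length w")
    case 0
    then have "m = 0" using that by simp
    then show ?thesis by simp
  next
    case (Suc n)
    then show ?thesis using that keys_mul[of m n x] by auto
  qed
  show ?case
    using mulx[OF snoc] mulx[OF keys_top_cell] keys_top_cell[of "Suc (length w)"]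
    by (auto simp: to_model_snoc simp del: top_cell.simps
        dest!: subsetD[OF keys_diff] subsetD[OF keys_add] split: if_splits)
qed auto

end

lemma alternating_frag_sum:
  "(\<Sum>i<n. frag_cmul ((-1) ^ i * r) x) = (if odd n then frag_cmul r x else 0)"
  by (induction n) (auto simp flip: frag_cmul_distrib)

definition append_letter :: "bool \<Rightarrow> (bool list \<Rightarrow>\<^sub>0 int) \<Rightarrow> (bool list \<Rightarrow>\<^sub>0 int)" where
  "append_letter x = frag_extend (\<lambda>w. frag_of (w @ [x]))"

text \<open>
  Appending \<open>x\<close> to \<open>w - (\<bottom>, \<dots>, \<bottom>)\<close>.  Unlike plain appending, this corresponds to right multiplication in
  the model for every chain.
\<close>

definition reduced_append :: "bool \<Rightarrow> (bool list \<Rightarrow>\<^sub>0 int) \<Rightarrow> (bool list \<Rightarrow>\<^sub>0 int)" where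
  "reduced_append x =
     frag_extend (\<lambda>w. frag_of (w @ [x]) - frag_of (replicate (length w) False @ [x]))"

lemma append_linear [simp]:
  "append_letter x (u - v) = append_letter x u - append_letter x v"
  "append_letter x (u + v) = append_letter x u + append_letter x v"
  "append_letter x (frag_cmul r u) = frag_cmul r (append_letter x u)"
  "append_letter x 0 = 0"
  "append_letter x (frag_of w) = frag_of (w @ [x])"
  "reduced_append x (u - v) = reduced_append x u - reduced_append x v"
  "reduced_append x (u + v) = reduced_append x u + reduced_append x v"
  "reduced_append x (frag_cmul r u) = frag_cmul r (reduced_append x u)"
  "reduced_append x 0 = 0"
  "reduced_append x (frag_of w) = frag_of (w @ [x]) - frag_of (replicate (length w) False @ [x])"
  by (simp_all add: append_letter_def reduced_append_def frag_extend_diff frag_extend_add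
      frag_extend_cmul)

lemma keys_reduced_append:
  assumes "Poly_Mapping.keys u \<subseteq> {w. length w = n}"
  shows "Poly_Mapping.keys (reduced_append x u) \<subseteq> {w. length w = Suc n}"
  unfolding reduced_append_def using assms
  by (intro order_trans[OF keys_frag_extend]) (fastforce dest: subsetD[OF keys_diff])

context four_term_scalars
begin

text \<open>
  Without the exception in degree \<open>0\<close>, where the value becomes \<open>\<Sigma>\<close> times the empty tuple, the recursion over
  the last entry holds uniformly.  The model does not see the difference, as it sends the empty
  tuple to \<open>0\<close>.
\<close>

definition augmented_boundary :: "bool list \<Rightarrow> (bool list \<Rightarrow>\<^sub>0 int)" where
  "augmented_boundary w = (\<Sum>i<length w. frag_cmul ((-1) ^ i)
     (frag_cmul (weight (w ! i)) (frag_of (take i w @ drop (Suc i) w)) +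
      frag_cmul (total - weight (w ! i)) (frag_of (replicate i (w ! i) @ drop (Suc i) w))))"

lemma augmented_boundary_Nil [simp]: "augmented_boundary [] = 0"
  by (simp add: augmented_boundary_def)

lemma augmented_boundary_snoc:
  "augmented_boundary (w @ [x]) = append_letter x (augmented_boundary w) +
     frag_cmul ((-1) ^ length w) (frag_cmul (weight x) (frag_of w) +
       frag_cmul (total - weight x) (frag_of (replicate (length w) x)))"
proof -
  have "append_letter x (augmented_boundary w) = (\<Sum>i<length w. frag_cmul ((-1) ^ i)
     (frag_cmul (weight (w ! i)) (frag_of (take i w @ drop (Suc i) w @ [x])) +
      frag_cmul (total - weight (w ! i)) (frag_of (replicate i (w ! i) @ drop (Suc i) w @ [x]))))"
    unfolding augmented_boundary_def append_letter_def
    by (simp add: frag_extend_sum o_def frag_extend_add frag_extend_cmul)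
  moreover have "augmented_boundary (w @ [x]) = (\<Sum>i<length w. frag_cmul ((-1) ^ i)
     (frag_cmul (weight (w ! i)) (frag_of (take i w @ drop (Suc i) w @ [x])) +
      frag_cmul (total - weight (w ! i)) (frag_of (replicate i (w ! i) @ drop (Suc i) w @ [x])))) +
     frag_cmul ((-1) ^ length w) (frag_cmul (weight x) (frag_of w) +
       frag_cmul (total - weight x) (frag_of (replicate (length w) x)))"
    unfolding augmented_boundary_def by (simp add: nth_append)
  ultimately show ?thesis by simp
qed

text \<open>
  The two summands of each face have total coefficient \<open>\<Sigma>\<close>, so maps that depend on the length
  only see \<open>\<Sigma>\<close> times an alternating sum of ones.
\<close>

lemma augmented_boundary_length:
  "frag_extend (\<lambda>v. F (length v)) (augmented_boundary w) =
     (if odd (length w) then frag_cmul total (F (length w - 1)) else 0)"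
proof -
  have "frag_extend (\<lambda>v. F (length v)) (augmented_boundary w) =
      (\<Sum>i<length w. frag_cmul ((-1) ^ i * total) (F (length w - 1)))"
    unfolding augmented_boundary_def
    by (simp add: frag_extend_sum o_def frag_extend_add frag_extend_cmul)
      (auto intro!: sum.cong simp: min_def simp flip: frag_cmul_distrib frag_cmul_cmul)
  then show ?thesis by (simp add: alternating_frag_sum)
qed

lemma keys_augmented_boundary:
  "Poly_Mapping.keys (augmented_boundary w) \<subseteq> {v. Suc (length v) = length w}"
  unfolding augmented_boundary_def
  by (rule order_trans[OF Poly_Mapping.keys_sum])
    (auto dest!: subsetD[OF keys_add] split: if_splits)

lemma to_model_append_letter:
  "to_model (append_letter x u) = mul x (to_model u) +
     frag_extend (\<lambda>w. if x then top_cell (Suc (length w)) - mul True (top_cell (length w)) else 0) u"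
  by (rule frag_linear_eq[where F = "\<lambda>u. to_model (append_letter x u)" and G = "\<lambda>u. mul x (to_model u) +
     frag_extend (\<lambda>w. if x then top_cell (Suc (length w)) - mul True (top_cell (length w)) else 0) u"])
    (simp_all add: to_model_snoc frag_extend_diff)

text \<open>
  Induction over the last entry.  For \<open>\<bottom>\<close> this is the Leibniz rule, since the constant tuple has image
  \<open>0\<close>.  For \<open>\<top>\<close> the remaining terms, the constant tuple and the correction terms of \<open>to_model\<close>, cancel because
  \<open>\<partial> u\<^sub>n\<close> is \<open>\<Sigma> u\<^bsub>n-1\<^esub>\<close> or \<open>0\<close> according to the parity of \<open>n\<close>.
\<close>

lemma to_model_augmented_boundary:
  "to_model (augmented_boundary w) = model_boundary (to_model (frag_of w))"
proof (induction w rule: rev_induct)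
  case (snoc x w)
  let ?n = "length w"
  have top: "model_boundary (top_cell (Suc ?n)) =
      (if even ?n then frag_cmul total (top_cell ?n) else 0)"
    by (cases ?n) (auto simp: model_boundary_of)
  have top': "model_boundary (top_cell ?n) =
      (if odd ?n then frag_cmul total (top_cell (?n - 1)) else 0)"
    by (cases ?n rule: top_cell.cases; cases "?n - 1") (auto simp: model_boundary_of)
  \<comment> \<open>The Leibniz rule, indexed by the length of the tuple; in length \<open>0\<close> the chain vanishes.\<close>
  have leib: "model_boundary (mul y m) =
      mul y (model_boundary m) + frag_cmul ((-1) ^ ?n * weight y) m"
    if "Poly_Mapping.keys m \<subseteq> {x. Suc (cell_degree x) = ?n}" for y m
  proof (cases ?n)
    case 0
    then have "m = 0" using that by simp
    then show ?thesis by simp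
  next
    case (Suc n)
    then show ?thesis using that model_boundary_mul[of m n y] by simp
  qed
  show ?case
  proof (cases x)
    case True
    have lhs: "to_model (augmented_boundary (w @ [x])) = mul True (to_model (augmented_boundary w)) +
        (if odd ?n then frag_cmul total (top_cell ?n - mul True (top_cell (?n - 1))) else 0) +
        frag_cmul ((-1) ^ ?n) (frag_cmul (weight True) (to_model (frag_of w)) +
          frag_cmul (total - weight True) (top_cell ?n))"
      using True augmented_boundary_length[of
          "\<lambda>n. top_cell (Suc n) - mul True (top_cell n)" w]
      by (simp add: augmented_boundary_snoc to_model_append_letter odd_pos del: top_cell.simps)
    have rhs: "model_boundary (to_model (frag_of (w @ [x]))) =
        mul True (model_boundary (to_model (frag_of w))) +
        frag_cmul ((-1) ^ ?n * weight True) (to_model (frag_of w)) +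
        (if even ?n then frag_cmul total (top_cell ?n) else 0) -
        (if odd ?n then frag_cmul total (mul True (top_cell (?n - 1))) else 0) -
        frag_cmul ((-1) ^ ?n * weight True) (top_cell ?n)"
      using True
      by (simp add: to_model_snoc leib[OF keys_to_model_of] leib[OF keys_top_cell] top top'
          del: top_cell.simps)
    show ?thesis
      unfolding lhs rhs snoc
      by (auto intro!: poly_mapping_eqI simp: frag_lookup algebra_simps)
  next
    case False
    then show ?thesis
      using snoc leib[OF keys_to_model_of, of False]
      by (auto intro!: poly_mapping_eqI simp: augmented_boundary_snoc to_model_append_letter
          to_model_snoc frag_extend_eq_0 frag_lookup)
  qed
qed simp

lemma boundary_of:
  "boundary a b c d (frag_of w) = (if length w \<le> 1 then 0 else augmented_boundary w)"
proof -
  have face: "face f i w = (if w ! i then map (\<lambda>x. f x True) (take i w) @ drop (Suc i) w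
      else map (\<lambda>x. f x False) (take i w) @ drop (Suc i) w)" for f i
    by (simp add: face_def)
  have prefix_const: "map (\<lambda>_. z) (take i w) = replicate i z" if "i < length w" for i and z :: bool
    using that by (simp add: map_replicate_const min_def)
  have weights: "weight True = a + c" "weight False = a + b"
    by (simp_all add: weight_def ab ac)
  have "frag_cmul a (frag_cmul ((-1) ^ i) (frag_of (face (\<lambda>x y. x) i w))) +
        frag_cmul b (frag_cmul ((-1) ^ i) (frag_of (face sup i w))) +
        frag_cmul c (frag_cmul ((-1) ^ i) (frag_of (face inf i w))) +
        frag_cmul d (frag_cmul ((-1) ^ i) (frag_of (face (\<lambda>x y. y) i w))) =
      frag_cmul ((-1) ^ i)
     (frag_cmul (weight (w ! i)) (frag_of (take i w @ drop (Suc i) w)) +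
      frag_cmul (total - weight (w ! i)) (frag_of (replicate i (w ! i) @ drop (Suc i) w)))"
    if "i < length w" for i
    using that
    by (cases "w ! i"; intro poly_mapping_eqI)
      (simp_all add: face prefix_const weights total_def frag_lookup algebra_simps
        del: lookup_frag_of)
  then show ?thesis
    by (simp add: boundary_def op_boundary_def augmented_boundary_def frag_cmul_sum
        flip: sum.distrib)
qed

lemma boundary_diff: "boundary a b c d (u - v) = boundary a b c d u - boundary a b c d v"
  by (intro poly_mapping_eqI)
    (simp add: boundary_def op_boundary_def frag_extend_diff frag_lookup algebra_simps)

lemma to_model_boundary: "to_model (boundary a b c d u) = model_boundary (to_model u)"
proof (rule frag_linear_eq[where F = "\<lambda>u. to_model (boundary a b c d u)"
        and G = "\<lambda>u. model_boundary (to_model u)"])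
  fix w :: "bool list"
  have "model_boundary (to_model (frag_of w)) = 0" if "length w \<le> 1"
  proof (cases w)
    case (Cons x v)
    with that have "w = replicate 1 x" by simp
    then show ?thesis
      by (cases x) (simp_all only: to_model_False to_model_True, simp_all add: model_boundary_of)
  qed simp
  then show "to_model (boundary a b c d (frag_of w)) = model_boundary (to_model (frag_of w))"
    by (simp add: boundary_of to_model_augmented_boundary)
qed (simp_all add: boundary_diff)

section \<open>From the model back to tuples\<close>

definition append_s :: "(bool list \<Rightarrow>\<^sub>0 int) \<Rightarrow> (bool list \<Rightarrow>\<^sub>0 int)" where
  "append_s u = frag_cmul p (reduced_append False u) + frag_cmul q (reduced_append True u)"

definition append_t :: "(bool list \<Rightarrow>\<^sub>0 int) \<Rightarrow> (bool list \<Rightarrow>\<^sub>0 int)" where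
  "append_t u = frag_cmul \<alpha> (reduced_append True u) - frag_cmul \<beta> (reduced_append False u)"

primrec cycle_chain :: "nat \<Rightarrow> cycle_letter list \<Rightarrow> (bool list \<Rightarrow>\<^sub>0 int)" where
  "cycle_chain k [] = frag_of (replicate (Suc k) True) - frag_of (replicate (Suc k) False)"
| "cycle_chain k (l # v) = (let u = cycle_chain k v in
     case l of T \<Rightarrow> append_t u | SS \<Rightarrow> append_s (append_s u)
     | ST \<Rightarrow> append_t (append_s u) + append_s (append_t u))"

definition from_model :: "(cell \<Rightarrow>\<^sub>0 int) \<Rightarrow> (bool list \<Rightarrow>\<^sub>0 int)" where
  "from_model = frag_extend (\<lambda>(k, v, e).
     if e then append_s (cycle_chain k v) else cycle_chain k v)"

lemma from_model_linear [simp]: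
  "from_model (x - y) = from_model x - from_model y" "from_model (x + y) = from_model x + from_model y"
  "from_model (frag_cmul r x) = frag_cmul r (from_model x)" "from_model 0 = 0"
  by (simp_all add: from_model_def frag_extend_diff frag_extend_add frag_extend_cmul)

lemma from_model_of [simp]:
  "from_model (frag_of (k, v, True)) = append_s (cycle_chain k v)"
  "from_model (frag_of (k, v, False)) = cycle_chain k v"
  by (simp_all add: from_model_def)

lemma append_st_linear [simp]:
  "append_s (u - v) = append_s u - append_s v" "append_t (u - v) = append_t u - append_t v"
  by (auto intro!: poly_mapping_eqI simp: append_s_def append_t_def frag_lookup algebra_simps)

lemma to_model_reduced_append: "to_model (reduced_append x u) = mul x (to_model u)"
  by (rule frag_linear_eq[where F = "\<lambda>u. to_model (reduced_append x u)"
        and G = "\<lambda>u. mul x (to_model u)"])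
    (simp_all add: to_model_snoc)

lemma unimodular': "\<alpha> * (p * z) + \<beta> * (q * z) = z"
  using arg_cong[OF unimodular, of "\<lambda>y. y * z"] by (simp add: algebra_simps)

lemma to_model_append_s: "to_model (append_s u) = mul_s (to_model u)"
  and to_model_append_t: "to_model (append_t u) = mul_t (to_model u)"
  by (auto intro!: poly_mapping_eqI simp: append_s_def append_t_def to_model_reduced_append mul_def
      frag_lookup algebra_simps unimodular')

lemma to_model_cycle_chain: "to_model (cycle_chain k v) = frag_of (k, v, False)"
proof (induction v)
  case Nil
  show ?case
    by (simp del: replicate_Suc)
next
  case (Cons l v)
  then show ?case
    by (cases l) (simp_all add: Let_def to_model_append_s to_model_append_t)
qed

lemma to_model_from_model: "to_model (from_model m) = m"
proof (rule frag_linear_eq[where F = "\<lambda>m. to_model (from_model m)" and G = "\<lambda>m. m"])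
  fix i :: cell
  obtain k v e where "i = (k, v, e)" by (cases i)
  then show "to_model (from_model (frag_of i)) = frag_of i"
    by (cases e) (simp_all add: to_model_append_s to_model_cycle_chain)
qed simp_all

lemma from_model_mul_st:
  "from_model (mul_s m) = append_s (from_model m)"
  "from_model (mul_t m) = append_t (from_model m)"
proof -
  show "from_model (mul_s m) = append_s (from_model m)"
  proof (rule frag_linear_eq[where F = "\<lambda>m. from_model (mul_s m)"
        and G = "\<lambda>m. append_s (from_model m)"])
    fix i :: cell
    obtain k v e where "i = (k, v, e)" by (cases i)
    then show "from_model (mul_s (frag_of i)) = append_s (from_model (frag_of i))"
      by (cases e) (simp_all add: Let_def)
  qed simp_all
  show "from_model (mul_t m) = append_t (from_model m)"
  proof (rule frag_linear_eq[where F = "\<lambda>m. from_model (mul_t m)"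
        and G = "\<lambda>m. append_t (from_model m)"])
    fix i :: cell
    obtain k v e where "i = (k, v, e)" by (cases i)
    then show "from_model (mul_t (frag_of i)) = append_t (from_model (frag_of i))"
      by (cases e) (simp_all add: Let_def)
  qed simp_all
qed

lemma from_model_mul: "from_model (mul x m) = reduced_append x (from_model m)"
  by (auto intro!: poly_mapping_eqI simp: append_s_def append_t_def mul_def from_model_mul_st
      frag_lookup algebra_simps unimodular')

text \<open>
  The composition is the projection along the constant tuple \<open>(\<bottom>, \<dots>, \<bottom>)\<close>; hence \<open>to_model\<close> loses exactly the
  chains of the subcomplex of the point \<open>\<bottom>\<close>.
\<close>

lemma from_model_to_model_of:
  "from_model (to_model (frag_of w)) = frag_of w - frag_of (replicate (length w) False)"
proof (induction w rule: rev_induct)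
  case (snoc x w)
  have top: "from_model (top_cell n) =
      frag_of (replicate n True) - frag_of (replicate n False)" for n
    by (cases n) simp_all
  show ?case
    by (simp add: to_model_snoc from_model_mul snoc top replicate_append_same del: top_cell.simps)
qed simp

lemma from_model_to_model:
  "from_model (to_model u) = u - frag_extend (\<lambda>w. frag_of (replicate (length w) False)) u"
  by (rule frag_linear_eq[where F = "\<lambda>u. from_model (to_model u)"
        and G = "\<lambda>u. u - frag_extend (\<lambda>w. frag_of (replicate (length w) False)) u"])
    (simp_all add: from_model_to_model_of frag_extend_diff)

lemma keys_append_st:
  assumes "Poly_Mapping.keys u \<subseteq> {w. length w = n}"
  shows "Poly_Mapping.keys (append_s u) \<subseteq> {w. length w = Suc n}"
    and "Poly_Mapping.keys (append_t u) \<subseteq> {w. length w = Suc n}"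
  using keys_reduced_append[OF assms]
  unfolding append_s_def append_t_def
  by (fastforce dest!: subsetD[OF keys_diff] subsetD[OF keys_add])+

lemma keys_cycle_chain:
  "Poly_Mapping.keys (cycle_chain k v) \<subseteq> {w. length w = Suc (k + word_degree v)}"
proof (induction v)
  case Nil
  show ?case by (auto dest!: subsetD[OF keys_diff])
next
  case (Cons l v)
  note s = keys_append_st(1) and t = keys_append_st(2)
  from Cons s[OF Cons] t[OF Cons] s[OF s[OF Cons]] s[OF t[OF Cons]] t[OF s[OF Cons]]
  show ?case
    by (cases l) (auto simp: Let_def dest!: subsetD[OF keys_add])
qed

lemma keys_from_model:
  assumes "Poly_Mapping.keys m \<subseteq> {x. cell_degree x = n}"
  shows "Poly_Mapping.keys (from_model m) \<subseteq> {w. length w = Suc n}"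
proof -
  have "Poly_Mapping.keys (from_model (frag_of x)) \<subseteq> {w. length w = Suc n}"
    if "cell_degree x = n" for x
  proof -
    obtain k v e where "x = (k, v, e)" by (cases x)
    then show ?thesis
      using that keys_cycle_chain[of k v] keys_append_st(1)[OF keys_cycle_chain[of k v]]
      by (cases e) auto
  qed
  then show ?thesis
    using assms keys_frag_extend[of "\<lambda>x. from_model (frag_of x)" m]
    unfolding from_model_def by (simp cong: if_cong) blast
qed

end

section \<open>Transfer of the relative homology to the model\<close>

definition cells :: "int \<Rightarrow> cell set" where
  "cells m = {x. int (cell_degree x) = m}"

context four_term_scalars
begin

abbreviation "bool_chains m \<equiv> chain_group (UNIV :: bool set) m"
abbreviation "point_chains m \<equiv> carrier (chain_group {False} m)"

text \<open>
  The cosets of the subcomplex of the point are the fibers of \<open>to_model\<close>, so a relative chain is named by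
  its image in the model.
\<close>

definition fiber :: "int \<Rightarrow> (cell \<Rightarrow>\<^sub>0 int) \<Rightarrow> (bool list \<Rightarrow>\<^sub>0 int) set" where
  "fiber m y = {u \<in> carrier (bool_chains m). to_model u = y}"

lemma keys_to_model:
  assumes "u \<in> carrier (bool_chains m)"
  shows "Poly_Mapping.keys (to_model u) \<subseteq> cells m"
  using assms keys_frag_extend[of "\<lambda>w. to_model (frag_of w)" u] keys_to_model_of
  unfolding to_model_def chain_group_def by (fastforce simp: cells_def tuples_def)

lemma from_model_in_chains:
  assumes "Poly_Mapping.keys y \<subseteq> cells m"
  shows "from_model y \<in> carrier (bool_chains m)"
proof (cases "m < 0")
  case True
  then have "y = 0" using assms by (auto simp: cells_def)
  then show ?thesis by (simp add: chain_group_def)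
next
  case False
  then have "Poly_Mapping.keys y \<subseteq> {x. cell_degree x = nat m}"
    using assms by (auto simp: cells_def)
  from keys_from_model[OF this] False show ?thesis
    by (fastforce simp: chain_group_def tuples_def)
qed

lemma boundary_in_chains:
  assumes "u \<in> carrier (bool_chains m)"
  shows "boundary a b c d u \<in> carrier (bool_chains (m - 1))"
proof -
  have "Poly_Mapping.keys u \<subseteq> tuples UNIV m"
    using assms by (simp add: chain_group_def)
  then show ?thesis
  proof (induction u rule: frag_induction)
    case zero
    show ?case using boundary_diff[of "0 :: bool list \<Rightarrow>\<^sub>0 int" 0] by (simp add: chain_group_def)
  next
    case (one w)
    then show ?case using keys_augmented_boundary[of w]
      by (fastforce simp: boundary_of chain_group_def tuples_def)
  next
    case (diff u v)
    then show ?case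
      by (auto simp: boundary_diff chain_group_def dest!: subsetD[OF keys_diff])
  qed
qed

lemma to_model_eq_0_iff:
  assumes "u \<in> carrier (bool_chains m)"
  shows "to_model u = 0 \<longleftrightarrow> u \<in> point_chains m"
proof
  assume "to_model u = 0"
  then have "frag_extend (\<lambda>w. frag_of (replicate (length w) False)) u = u"
    using from_model_to_model[of u] by simp
  then have "Poly_Mapping.keys u \<subseteq> (\<Union>w\<in>Poly_Mapping.keys u. {replicate (length w) False})"
    using keys_frag_extend[of "\<lambda>w. frag_of (replicate (length w) False)" u] by simp
  then show "u \<in> point_chains m"
    using assms by (fastforce simp: chain_group_def tuples_def)
next
  assume "u \<in> point_chains m"
  then have "w = replicate (length w) False" if "w \<in> Poly_Mapping.keys u" for w
    using that by (auto simp: chain_group_def tuples_def intro!: replicate_eqI)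
  then have "to_model (frag_of w) = 0" if "w \<in> Poly_Mapping.keys u" for w
    using that to_model_False by metis
  then show "to_model u = 0"
    by (auto simp: to_model_def intro!: frag_extend_eq_0)
qed

lemma point_chains_subset: "point_chains m \<subseteq> carrier (bool_chains m)"
  by (auto simp: chain_group_def tuples_def)

lemma to_model_group_hom: "group_hom (bool_chains m) (free_Abelian_group (cells m)) to_model"
  using keys_to_model
  by (auto simp: group_hom_def group_hom_axioms_def chain_group_def intro!: homI)

lemma point_chains_kernel:
  "point_chains m = kernel (bool_chains m) (free_Abelian_group (cells m)) to_model"
  using to_model_eq_0_iff point_chains_subset by (fastforce simp: kernel_def)

lemma point_chains_normal: "point_chains m \<lhd> bool_chains m"
  unfolding point_chains_kernel by (rule group_hom.normal_kernel[OF to_model_group_hom])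

lemma coset_eq_fiber:
  assumes "u \<in> carrier (bool_chains m)"
  shows "point_chains m #>\<^bsub>bool_chains m\<^esub> u = fiber m (to_model u)"
proof -
  have mult: "x \<otimes>\<^bsub>bool_chains m\<^esub> y = x + y" for x y
    by (simp add: chain_group_def)
  have minus: "v - u \<in> carrier (bool_chains m)" if "v \<in> carrier (bool_chains m)" for v
    using assms that by (auto simp: chain_group_def dest!: subsetD[OF keys_diff])
  have plus: "v + u \<in> carrier (bool_chains m)" if "v \<in> carrier (bool_chains m)" for v
    using assms that by (auto simp: chain_group_def dest!: subsetD[OF keys_add])
  show ?thesis
  proof
    show "point_chains m #>\<^bsub>bool_chains m\<^esub> u \<subseteq> fiber m (to_model u)"
    proof
      fix v assume "v \<in> point_chains m #>\<^bsub>bool_chains m\<^esub> u"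
      then obtain z where z: "z \<in> point_chains m" "v = z + u"
        by (auto simp: r_coset_def mult)
      then have "z \<in> carrier (bool_chains m)" using point_chains_subset by blast
      with z show "v \<in> fiber m (to_model u)"
        using to_model_eq_0_iff[of z m] plus[of z] by (simp add: fiber_def)
    qed
    show "fiber m (to_model u) \<subseteq> point_chains m #>\<^bsub>bool_chains m\<^esub> u"
    proof
      fix v assume "v \<in> fiber m (to_model u)"
      then have "v - u \<in> point_chains m"
        using minus[of v] to_model_eq_0_iff[of "v - u" m] by (auto simp: fiber_def)
      then show "v \<in> point_chains m #>\<^bsub>bool_chains m\<^esub> u"
        unfolding r_coset_def mult by (intro UN_I[of "v - u"]) simp_all
    qed
  qed
qed

lemma fiber_eq_coset:
  assumes "Poly_Mapping.keys y \<subseteq> cells m"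
  shows "fiber m y = point_chains m #>\<^bsub>bool_chains m\<^esub> from_model y"
  using coset_eq_fiber[OF from_model_in_chains[OF assms]] by (simp add: to_model_from_model)

lemma carrier_rel_chain_group:
  "carrier (rel_chain_group False m) = fiber m ` {y. Poly_Mapping.keys y \<subseteq> cells m}"
proof -
  have "to_model ` carrier (bool_chains m) = {y. Poly_Mapping.keys y \<subseteq> cells m}"
  proof
    show "{y. Poly_Mapping.keys y \<subseteq> cells m} \<subseteq> to_model ` carrier (bool_chains m)"
    proof
      fix y :: "cell \<Rightarrow>\<^sub>0 int"
      assume "y \<in> {y. Poly_Mapping.keys y \<subseteq> cells m}"
      then show "y \<in> to_model ` carrier (bool_chains m)"
        using from_model_in_chains[of y m] to_model_from_model[of y]
          image_eqI[of y to_model "from_model y"] by simp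
    qed
  qed (use keys_to_model in blast)
  moreover have "carrier (rel_chain_group False m) = (\<lambda>u. fiber m (to_model u)) ` carrier (bool_chains m)"
    unfolding rel_chain_group_def carrier_FactGroup by (rule image_cong) (simp_all add: coset_eq_fiber)
  ultimately show ?thesis by (simp add: image_image[symmetric])
qed

lemma mult_rel_chain_group:
  assumes "Poly_Mapping.keys y \<subseteq> cells m" "Poly_Mapping.keys z \<subseteq> cells m"
  shows "fiber m y \<otimes>\<^bsub>rel_chain_group False m\<^esub> fiber m z = fiber m (y + z)"
proof -
  have yz: "Poly_Mapping.keys (y + z) \<subseteq> cells m"
    using assms keys_add[of y z] by blast
  have "from_model y \<otimes>\<^bsub>bool_chains m\<^esub> from_model z = from_model (y + z)"
    by (simp add: chain_group_def)
  then show ?thesis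
    using normal.rcos_sum[OF point_chains_normal, of "from_model y" m "from_model z"]
    by (simp add: assms yz fiber_eq_coset rel_chain_group_def from_model_in_chains)
qed

lemma one_rel_chain_group: "\<one>\<^bsub>rel_chain_group False m\<^esub> = fiber m 0"
  using point_chains_subset to_model_eq_0_iff by (auto simp: rel_chain_group_def fiber_def)

lemma group_rel_chain_group: "group (rel_chain_group False m)"
  unfolding rel_chain_group_def by (rule normal.factorgroup_is_group[OF point_chains_normal])

lemma to_model_fiber:
  assumes "Poly_Mapping.keys y \<subseteq> cells m"
  shows "to_model ` fiber m y = {y}"
  using from_model_in_chains[OF assms] to_model_from_model[of y]
  by (force simp: fiber_def image_iff)

lemma fiber_inject:
  assumes "Poly_Mapping.keys y \<subseteq> cells m" "Poly_Mapping.keys z \<subseteq> cells m"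
  shows "fiber m y = fiber m z \<longleftrightarrow> y = z"
  using to_model_fiber[OF assms(1)] to_model_fiber[OF assms(2)] by auto

lemma keys_model_boundary:
  assumes "Poly_Mapping.keys y \<subseteq> cells m"
  shows "Poly_Mapping.keys (model_boundary y) \<subseteq> cells (m - 1)"
  using keys_to_model[OF boundary_in_chains[OF from_model_in_chains[OF assms]]]
  by (simp add: to_model_boundary to_model_from_model)

lemma rel_boundary_fiber:
  assumes y: "Poly_Mapping.keys y \<subseteq> cells m"
  shows "rel_boundary a b c d False m (fiber m y) = fiber (m - 1) (model_boundary y)"
proof -
  have coset: "point_chains (m - 1) #>\<^bsub>bool_chains (m - 1)\<^esub> boundary a b c d u =
      fiber (m - 1) (model_boundary y)" if "u \<in> fiber m y" for u
    using that coset_eq_fiber[OF boundary_in_chains]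
    by (auto simp: fiber_def to_model_boundary)
  have "rel_boundary a b c d False m (fiber m y) =
      (\<Union>u\<in>fiber m y. point_chains (m - 1) #>\<^bsub>bool_chains (m - 1)\<^esub> boundary a b c d u)"
    by (auto simp: rel_boundary_def set_mult_def r_coset_def)
  also have "\<dots> = fiber (m - 1) (model_boundary y)"
    using coset to_model_fiber[OF y] by auto
  finally show ?thesis .
qed

lemma rel_boundary_group_hom:
  "group_hom (rel_chain_group False m) (rel_chain_group False (m - 1)) (rel_boundary a b c d False m)"
proof -
  have add: "Poly_Mapping.keys (y + z) \<subseteq> cells m"
    if "Poly_Mapping.keys y \<subseteq> cells m" "Poly_Mapping.keys z \<subseteq> cells m" for y z
    using that keys_add[of y z] by blast
  have "rel_boundary a b c d False m \<in> hom (rel_chain_group False m) (rel_chain_group False (m - 1))"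
    by (rule homI)
      (auto simp: carrier_rel_chain_group rel_boundary_fiber mult_rel_chain_group
        keys_model_boundary add)
  then show ?thesis
    by (simp add: group_hom_def group_hom_axioms_def group_rel_chain_group)
qed

lemma kernel_rel_boundary:
  "kernel (rel_chain_group False m) (rel_chain_group False (m - 1)) (rel_boundary a b c d False m) =
     fiber m ` {y. Poly_Mapping.keys y \<subseteq> cells m \<and> model_boundary y = 0}"
proof -
  have "fiber (m - 1) (model_boundary y) = fiber (m - 1) 0 \<longleftrightarrow> model_boundary y = 0"
    if "Poly_Mapping.keys y \<subseteq> cells m" for y
    using fiber_inject[OF keys_model_boundary[OF that], of 0] by simp
  then show ?thesis
    by (auto simp: kernel_def carrier_rel_chain_group rel_boundary_fiber one_rel_chain_group)
qed

text \<open>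
  Each coordinate of a boundary involves at most two coordinates of the chain, all for the same word \<open>v\<close>: this is
  the splitting into small complexes.
\<close>

lemma lookup_model_boundary:
  "poly_mapping.lookup (model_boundary x) (k, v, False) =
     (if odd k then total * poly_mapping.lookup x (Suc k, v, False) else 0) +
     (-1) ^ (k + word_degree v + 1) * g * poly_mapping.lookup x (k, v, True)"
  "poly_mapping.lookup (model_boundary x) (k, v, True) =
     (if odd k then total * poly_mapping.lookup x (Suc k, v, True) else 0)"
proof -
  have "Poly_Mapping.keys x \<subseteq> UNIV" by simp
  then have "poly_mapping.lookup (model_boundary x) (k, v, False) =
     (if odd k then total * poly_mapping.lookup x (Suc k, v, False) else 0) +
     (-1) ^ (k + word_degree v + 1) * g * poly_mapping.lookup x (k, v, True) \<and>
     poly_mapping.lookup (model_boundary x) (k, v, True) =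
     (if odd k then total * poly_mapping.lookup x (Suc k, v, True) else 0)"
  proof (induction x rule: frag_induction)
    case (one i)
    obtain k' v' e' where i: "i = (k', v', e')" by (cases i)
    have "k = k' - 1 \<and> even k' \<and> 0 < k' \<longleftrightarrow> odd k \<and> k' = Suc k"
      by (auto elim: oddE)
    then show ?case
      by (auto simp: i model_boundary_of frag_lookup)
  qed (auto simp: frag_lookup algebra_simps)
  then show "poly_mapping.lookup (model_boundary x) (k, v, False) =
     (if odd k then total * poly_mapping.lookup x (Suc k, v, False) else 0) +
     (-1) ^ (k + word_degree v + 1) * g * poly_mapping.lookup x (k, v, True)"
  "poly_mapping.lookup (model_boundary x) (k, v, True) =
     (if odd k then total * poly_mapping.lookup x (Suc k, v, True) else 0)"
    by simp_all
qed

lemma model_boundary_square: "model_boundary (model_boundary x) = 0"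
proof (rule poly_mapping_eqI)
  fix i :: cell
  obtain k v e where "i = (k, v, e)" by (cases i)
  then show "poly_mapping.lookup (model_boundary (model_boundary x)) i = poly_mapping.lookup 0 i"
    by (cases e) (auto simp: lookup_model_boundary)
qed

text \<open>
  The computation of relative homology is thereby reduced to integer coordinates in the model.
\<close>

lemma rel_homology_by_coordinates:
  assumes hom: "\<And>j y z. \<phi> j (y + z) = \<phi> j y + \<phi> j z"
    and surj: "\<And>f :: 'j \<Rightarrow> int. \<exists>y. Poly_Mapping.keys y \<subseteq> cells m \<and> model_boundary y = 0 \<and>
      (\<forall>j\<in>J. \<phi> j y = f j)"
    and boundaries: "\<And>y. Poly_Mapping.keys y \<subseteq> cells m \<Longrightarrow> model_boundary y = 0 \<Longrightarrow>
      (\<exists>x. Poly_Mapping.keys x \<subseteq> cells (m + 1) \<and> model_boundary x = y) \<longleftrightarrow>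
      (\<forall>j\<in>J. \<mu> j dvd \<phi> j y)"
  shows "rel_homology_group a b c d False m \<cong> product_group J (\<lambda>j. Zmod (\<mu> j))"
proof -
  let ?R = "rel_chain_group False m"
  let ?K = "kernel ?R (rel_chain_group False (m - 1)) (rel_boundary a b c d False m)"
  let ?Z = "{y. Poly_Mapping.keys y \<subseteq> cells m \<and> model_boundary y = 0}"
  let ?B = "rel_boundary a b c d False (m + 1) ` carrier (rel_chain_group False (m + 1))"
  interpret group_hom ?R "rel_chain_group False (m - 1)" "rel_boundary a b c d False m"
    by (rule rel_boundary_group_hom)
  let ?G = "subgroup_generated ?R ?K"
  define \<psi> where "\<psi> j A = \<phi> j (the_elem (to_model ` A))" for j A
  have carrier: "carrier ?G = fiber m ` ?Z"
    using subgroup.carrier_subgroup_generated_subgroup[OF subgroup_kernel]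
    by (simp add: kernel_rel_boundary)
  have B: "?B = fiber m ` (model_boundary ` {x. Poly_Mapping.keys x \<subseteq> cells (m + 1)})"
    unfolding carrier_rel_chain_group image_image
    by (rule image_cong) (simp_all add: rel_boundary_fiber)
  have \<psi>_fiber [simp]: "\<psi> j (fiber m y) = \<phi> j y" if "Poly_Mapping.keys y \<subseteq> cells m" for j y
    using that by (simp add: \<psi>_def to_model_fiber)
  have sum_cells: "Poly_Mapping.keys (y + z) \<subseteq> cells m"
    if "Poly_Mapping.keys y \<subseteq> cells m" "Poly_Mapping.keys z \<subseteq> cells m" for y z
    using that keys_add[of y z] by blast
  have boundary_cells: "Poly_Mapping.keys (model_boundary x) \<subseteq> cells m"
    if "Poly_Mapping.keys x \<subseteq> cells (m + 1)" for x
    using keys_model_boundary[OF that] by simp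
  have "?G Mod ?B \<cong> product_group J (\<lambda>j. Zmod (\<mu> j))"
  proof (rule quotient_iso_product_Zmod[where \<phi> = \<psi>])
    show "group ?G" by simp
    show "\<psi> j (A \<otimes>\<^bsub>?G\<^esub> A') = \<psi> j A + \<psi> j A'" if "A \<in> carrier ?G" "A' \<in> carrier ?G" for j A A'
      using that by (auto simp: carrier mult_rel_chain_group sum_cells hom)
    show "\<exists>A\<in>carrier ?G. \<forall>j\<in>J. \<psi> j A = f j" for f :: "'j \<Rightarrow> int"
    proof -
      from surj[of f] obtain y where "y \<in> ?Z" "\<forall>j\<in>J. \<phi> j y = f j" by blast
      then show ?thesis by (intro bexI[of _ "fiber m y"]) (auto simp: carrier)
    qed
    show "?B \<subseteq> carrier ?G"
      unfolding B carrier using boundary_cells model_boundary_square by blast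
    show "A \<in> ?B \<longleftrightarrow> (\<forall>j\<in>J. \<mu> j dvd \<psi> j A)" if "A \<in> carrier ?G" for A
    proof -
      from that obtain y where y: "Poly_Mapping.keys y \<subseteq> cells m" "model_boundary y = 0"
        "A = fiber m y" by (auto simp: carrier)
      have "A \<in> ?B \<longleftrightarrow> (\<exists>x. Poly_Mapping.keys x \<subseteq> cells (m + 1) \<and> model_boundary x = y)"
        unfolding B y(3) using fiber_inject[OF y(1) boundary_cells] by (auto simp: image_iff)
      then show ?thesis using boundaries[OF y(1,2)] y by simp
    qed
  qed
  then show ?thesis
    by (simp add: rel_homology_group_def)
qed

end

section \<open>Counting words and cells\<close>

definition words :: "nat \<Rightarrow> cycle_letter list set" where
  "words n = {v. word_degree v = n}"

definition short_words :: "nat \<Rightarrow> cycle_letter list set" where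
  "short_words n = {v. word_degree v < n}"

lemma words_0: "words 0 = {[]}"
proof -
  have "word_degree v = 0 \<longleftrightarrow> v = []" for v
    by (cases v; cases "hd v") auto
  then show ?thesis by (auto simp: words_def)
qed

lemma words_1: "words (Suc 0) = {[T]}"
proof -
  have "word_degree v = Suc 0 \<longleftrightarrow> v = [T]" for v
  proof (cases v)
    case (Cons l u)
    then show ?thesis
      using words_0 by (cases l) (auto simp: words_def)
  qed simp
  then show ?thesis by (auto simp: words_def)
qed

lemma words_Suc_Suc:
  "words (Suc (Suc n)) = (#) T ` words (Suc n) \<union> ((#) SS ` words n \<union> (#) ST ` words n)"
proof (rule Set.set_eqI)
  fix v
  show "v \<in> words (Suc (Suc n)) \<longleftrightarrow>
      v \<in> (#) T ` words (Suc n) \<union> ((#) SS ` words n \<union> (#) ST ` words n)"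
  proof (cases v)
    case (Cons l u)
    then show ?thesis by (cases l) (auto simp: words_def)
  qed (auto simp: words_def)
qed

lemma finite_words [simp]: "finite (words n)"
  by (induction n rule: induct_nat_012) (simp_all add: words_0 words_1 words_Suc_Suc)

text \<open>
  A form of \<open>r_seq\<close> without division and case distinction, so that its recurrences become linear arithmetic.
\<close>

lemma three_r_seq: "3 * int (r_seq n) = 2 ^ (n + 1) + (-1) ^ n"
proof -
  have "(3 :: int) dvd 2 ^ (n + 1) + (-1) ^ n"
  proof (induction n)
    case (Suc n)
    have "(2 :: int) ^ (Suc n + 1) + (-1) ^ Suc n = 2 * (2 ^ (n + 1) + (-1) ^ n) - 3 * (-1) ^ n"
      by simp
    then show ?case using Suc by (metis dvd_diff dvd_mult dvd_triv_left)
  qed simp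
  moreover have "int (r_seq n) = (2 ^ (n + 1) + (-1) ^ n) div 3"
    by (simp add: r_seq_def zdiv_int of_nat_diff add.commute)
  ultimately show ?thesis by simp
qed

lemma card_words: "card (words n) = r_seq n"
proof (induction n rule: induct_nat_012)
  case (ge2 n)
  have "card (words (Suc (Suc n))) = r_seq (Suc n) + (r_seq n + r_seq n)"
    unfolding words_Suc_Suc
    by (subst card_Un_disjoint, simp, simp, force, subst card_Un_disjoint, simp, simp, force)
      (simp add: card_image ge2)
  moreover have "int (r_seq (Suc (Suc n))) = int (r_seq (Suc n) + (r_seq n + r_seq n))"
    using three_r_seq[of n] three_r_seq[of "Suc n"] three_r_seq[of "Suc (Suc n)"] by simp
  ultimately show ?case by simp
qed (simp_all add: words_0 words_1 r_seq_def)

lemma short_words_Suc: "short_words (Suc n) = short_words n \<union> words n"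
  by (auto simp: short_words_def words_def)

lemma finite_short_words [simp]: "finite (short_words n)"
  by (induction n) (simp_all add: short_words_Suc, simp add: short_words_def)

lemma card_short_words: "card (short_words n) + parity (n + 1) = r_seq n"
proof (induction n)
  case 0
  show ?case by (simp add: short_words_def parity_def r_seq_def)
next
  case (Suc n)
  have "card (short_words (Suc n)) = card (short_words n) + r_seq n"
    unfolding short_words_Suc
    by (subst card_Un_disjoint) (auto simp: card_words, auto simp: words_def short_words_def)
  moreover have "int (r_seq (Suc n)) + (if even n then 1 else 0) =
      2 * int (r_seq n) + (if odd n then 1 else 0)"
    using three_r_seq[of n] three_r_seq[of "Suc n"] by (cases "even n") simp_all
  ultimately show ?case
    using Suc by (auto simp: parity_def split: if_splits)
qed

lemma card_words_pred: "card {v. word_degree v + 1 = n} + r_seq n = 2 ^ n"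
proof (cases n)
  case (Suc n')
  then have "{v. word_degree v + 1 = n} = words n'"
    by (auto simp: words_def)
  moreover have "int (r_seq n') + int (r_seq n) = int (2 ^ n)"
    using three_r_seq[of n'] three_r_seq[of n] Suc by simp
  ultimately show ?thesis by (simp add: card_words flip: of_nat_add)
qed (simp add: r_seq_def)

lemma cells_eq:
  "cells (int n) = (\<lambda>v. (n - word_degree v, v, False)) ` short_words (Suc n) \<union>
     (\<lambda>v. (n - 1 - word_degree v, v, True)) ` short_words n"
proof (rule Set.set_eqI)
  fix i :: cell
  obtain k v e where "i = (k, v, e)" by (cases i)
  then show "i \<in> cells (int n) \<longleftrightarrow> i \<in> (\<lambda>v. (n - word_degree v, v, False)) ` short_words (Suc n) \<union>
     (\<lambda>v. (n - 1 - word_degree v, v, True)) ` short_words n"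
    by (cases e) (auto simp: cells_def short_words_def image_iff)
qed

lemma finite_cells: "finite (cells (int n))"
  by (simp add: cells_eq)

lemma card_cells: "card (cells (int n)) = 2 ^ (n + 1) - 1"
proof -
  have "card (cells (int n)) = card (short_words (Suc n)) + card (short_words n)"
    unfolding cells_eq
    by (subst card_Un_disjoint) (auto simp: card_image inj_on_def)
  moreover have "int (card (short_words (Suc n)) + card (short_words n)) = 2 ^ (n + 1) - 1"
    using card_short_words[of n] card_short_words[of "Suc n"] three_r_seq[of n]
      three_r_seq[of "Suc n"]
    by (auto simp: parity_def split: if_splits)
  ultimately show ?thesis by (simp add: of_nat_diff nat_int_comparison(1))
qed

lemma ex_chain_with_coordinates:
  fixes F :: "'a \<Rightarrow> int"
  assumes "finite I"
  obtains y where "Poly_Mapping.keys y \<subseteq> I"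
    and "\<And>i. poly_mapping.lookup y i = (if i \<in> I then F i else 0)"
proof
  let ?y = "Abs_poly_mapping (\<lambda>i. if i \<in> I then F i else 0)"
  have *: "poly_mapping.lookup ?y = (\<lambda>i. if i \<in> I then F i else 0)"
    by (rule lookup_Abs_poly_mapping) (rule finite_subset[OF _ assms], auto)
  then show "\<And>i. poly_mapping.lookup ?y i = (if i \<in> I then F i else 0)" by simp
  show "Poly_Mapping.keys ?y \<subseteq> I"
    by (auto simp: in_keys_iff * split: if_splits)
qed

lemma lookup_eq_0: "Poly_Mapping.keys y \<subseteq> I \<Longrightarrow> i \<notin> I \<Longrightarrow> poly_mapping.lookup y i = 0"
  by (auto simp: in_keys_iff)

context four_term_scalars
begin

section \<open>Homology of the model\<close>


lemma rel_homology_all_zero: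
  assumes "g = 0" "total = 0"
  shows "rel_homology_group a b c d False (int n) \<cong> product_group (cells (int n)) (\<lambda>_. Zmod 0)"
proof (rule rel_homology_by_coordinates[where \<phi> = "\<lambda>i y. poly_mapping.lookup y i"])
  have zero: "model_boundary x = 0" for x
  proof (rule poly_mapping_eqI)
    fix i :: cell
    obtain k v e where "i = (k, v, e)" by (cases i)
    then show "poly_mapping.lookup (model_boundary x) i = poly_mapping.lookup 0 i"
      by (cases e) (simp_all only: lookup_model_boundary, simp_all add: assms)
  qed
  show "\<exists>y. Poly_Mapping.keys y \<subseteq> cells (int n) \<and> model_boundary y = 0 \<and>
      (\<forall>i\<in>cells (int n). poly_mapping.lookup y i = f i)" for f
  proof -
    obtain y where "Poly_Mapping.keys y \<subseteq> cells (int n)"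
      "\<And>i. poly_mapping.lookup y i = (if i \<in> cells (int n) then f i else 0)"
      using ex_chain_with_coordinates[OF finite_cells] by blast
    then show ?thesis using zero by (intro exI[of _ y]) simp
  qed
  show "(\<exists>x. Poly_Mapping.keys x \<subseteq> cells (int n + 1) \<and> model_boundary x = y) \<longleftrightarrow>
      (\<forall>i\<in>cells (int n). 0 dvd poly_mapping.lookup y i)"
    if "Poly_Mapping.keys y \<subseteq> cells (int n)" for y
  proof
    assume "\<forall>i\<in>cells (int n). 0 dvd poly_mapping.lookup y i"
    then have "poly_mapping.lookup y i = 0" for i
      using lookup_eq_0[OF that] by (cases "i \<in> cells (int n)") auto
    then have "y = 0" by (intro poly_mapping_eqI) simp
    then show "\<exists>x. Poly_Mapping.keys x \<subseteq> cells (int n + 1) \<and> model_boundary x = y"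
      by (intro exI[of _ 0]) simp
  qed (use zero in auto)
qed (simp add: lookup_add)

text \<open>
  Indices of the cyclic summands of the homology in degree \<open>n\<close>.  The index \<open>(v, False)\<close> is the class of the word
  \<open>v\<close>; its position in the small complex of \<open>v\<close> is \<open>n - word_degree v\<close>, and position \<open>0\<close> gives \<open>\<int>\<^sub>g\<close>.  The index
  \<open>(v, True)\<close> is the class of \<open>u\<^sub>0 v s\<close>, which is a cycle only if \<open>g = 0\<close>; in that case it generates \<open>\<int> = \<int>\<^sub>g\<close>.
\<close>

definition g_classes :: "nat \<Rightarrow> (cycle_letter list \<times> bool) set" where
  "g_classes n = (\<lambda>v. (v, False)) ` words n \<union>
     (if g = 0 then (\<lambda>v. (v, True)) ` {v. word_degree v + 1 = n} else {})"

definition gcd_classes :: "nat \<Rightarrow> (cycle_letter list \<times> bool) set" where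
  "gcd_classes n = (\<lambda>v. (v, False)) ` short_words n"

text \<open>
  In position \<open>i\<close> of the small complex of \<open>v\<close>, a chain has the coordinates \<open>y\<^sub>1\<close> of \<open>u\<^sub>i v\<close> and, if \<open>i > 0\<close>,
  \<open>y\<^sub>2\<close> of \<open>u\<^bsub>i-1\<^esub> v s\<close>.  Put \<open>\<gamma> = gcd g \<Sigma>\<close>.

  For \<open>i = 0\<close> the boundaries are the multiples of \<open>g\<close>.  For odd \<open>i\<close> the coordinate \<open>y\<^sub>1\<close> is free and the
  boundaries have \<open>y\<^sub>1 \<in> g\<int> + \<Sigma>\<int> = \<gamma>\<int>\<close>; moreover \<open>y\<^sub>2 = 0\<close> on cycles, except for \<open>i = 1\<close> and \<open>g = 0\<close>, where \<open>y\<^sub>2\<close> is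
  free and vanishes on boundaries.  For even \<open>i > 0\<close> the cycles are the solutions of \<open>\<Sigma> y\<^sub>1 = \<plusminus>g y\<^sub>2\<close>, a group generated by
  \<open>(\<plusminus>g/\<gamma>, \<Sigma>/\<gamma>)\<close>, and the boundaries are generated by \<open>(\<plusminus>g, \<Sigma>)\<close>.  A Bezout relation for \<open>g\<close>
  and \<open>\<Sigma>\<close> turns the position along the generator into an integral linear coordinate.
\<close>

lemma rel_homology_nonzero:
  assumes nonzero: "g \<noteq> 0 \<or> total \<noteq> 0"
  shows "rel_homology_group a b c d False (int n) \<cong> product_group (g_classes n \<union> gcd_classes n)
     (\<lambda>j. Zmod (if j \<in> g_classes n then g else gcd g total))"
proof -
  define \<gamma> where "\<gamma> = gcd g total"
  define g' where "g' = g div \<gamma>"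
  define t' where "t' = total div \<gamma>"
  define s :: int where "s = (-1) ^ (n + 1)"
  have \<gamma>: "\<gamma> \<noteq> 0" and g: "g = \<gamma> * g'" and t: "total = \<gamma> * t'"
    using nonzero by (simp_all add: \<gamma>_def g'_def t'_def)
  obtain P Q where "P * g + Q * total = \<gamma>"
    unfolding \<gamma>_def using bezout_int by blast
  then have "\<gamma> * (P * g' + Q * t') = \<gamma> * 1"
    using g t by (simp add: algebra_simps)
  then have PQ: "P * g' + Q * t' = 1"
    using \<gamma> by simp
  have exchange: "total * g' = g * t'"
    using g t by (metis mult.assoc mult.commute)
  have ss: "s * s = 1" "s * (s * z) = z" for z
    by (simp_all add: s_def flip: mult.assoc power_add)
  define \<phi> where "\<phi> j y = (case j of (v, e) \<Rightarrow> if e then poly_mapping.lookup y (0, v, True)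
      else let i = n - word_degree v in
        if i = 0 \<or> odd i then poly_mapping.lookup y (i, v, False)
        else P * s * poly_mapping.lookup y (i, v, False) + Q * poly_mapping.lookup y (i - 1, v, True))"
    for j :: "cycle_letter list \<times> bool" and y :: "cell \<Rightarrow>\<^sub>0 int"
  define J where "J = g_classes n \<union> gcd_classes n"
  define \<mu> where "\<mu> j = (if j \<in> g_classes n then g else \<gamma>)" for j
  have J_False: "(v, False) \<in> J \<longleftrightarrow> word_degree v \<le> n" for v
    by (auto simp: J_def g_classes_def gcd_classes_def words_def short_words_def image_iff)
  have J_True: "(v, True) \<in> J \<longleftrightarrow> g = 0 \<and> word_degree v + 1 = n" for v
    by (auto simp: J_def g_classes_def gcd_classes_def)
  have \<mu>_False: "\<mu> (v, False) = (if word_degree v = n then g else \<gamma>)" for v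
    by (auto simp: \<mu>_def g_classes_def words_def)
  have \<mu>_True: "\<mu> (v, True) = 0" if "g = 0" "word_degree v + 1 = n" for v
  proof -
    have "(v, True) \<in> g_classes n"
      unfolding g_classes_def using that by auto
    then have "\<mu> (v, True) = g" by (simp add: \<mu>_def)
    with that(1) show ?thesis by simp
  qed
  have "rel_homology_group a b c d False (int n) \<cong> product_group J (\<lambda>j. Zmod (\<mu> j))"
  proof (rule rel_homology_by_coordinates[where \<phi> = \<phi>])
    show "\<phi> j (y + z) = \<phi> j y + \<phi> j z" for j y z
      by (auto simp: \<phi>_def Let_def lookup_add algebra_simps split: prod.split)
  next
    fix f :: "cycle_letter list \<times> bool \<Rightarrow> int"
    \<comment> \<open>In even positions the coordinate multiplies the generator of the cycles.\<close>
    define F where "F i = (case i of (k, v, e) \<Rightarrow>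
        if e then (if k = 0 then (if g = 0 then f (v, True) else 0)
          else if odd k then t' * f (v, False) else 0)
        else if k = 0 \<or> odd k then f (v, False) else s * g' * f (v, False))" for i :: cell
    obtain y where y: "Poly_Mapping.keys y \<subseteq> cells (int n)"
      and ly: "\<And>i. poly_mapping.lookup y i = (if i \<in> cells (int n) then F i else 0)"
      using ex_chain_with_coordinates[OF finite_cells] by blast
    have "model_boundary y = 0"
    proof (rule poly_mapping_eqI)
      fix i :: cell
      obtain k v e where i: "i = (k, v, e)" by (cases i)
      show "poly_mapping.lookup (model_boundary y) i = poly_mapping.lookup 0 i"
      proof (cases e)
        case True
        then show ?thesis by (auto simp: i lookup_model_boundary ly F_def)
      next
        case False
        show ?thesis
        proof (cases "Suc (k + word_degree v) = n")
          case True
          have sign: "(-1) ^ (k + word_degree v + 1) = - s"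
            by (simp add: s_def flip: True)
          have cancel: "total * (s * g' * z) - s * g * (t' * z) = 0" for z
            using arg_cong[OF exchange, of "\<lambda>x. s * x * z"] by (simp add: algebra_simps)
          have e: "e = False" using False by simp
          have "poly_mapping.lookup y (Suc k, v, False) = F (Suc k, v, False)"
            "poly_mapping.lookup y (k, v, True) = F (k, v, True)"
            using True by (auto simp: ly cells_def)
          then show ?thesis
            unfolding i e lookup_model_boundary sign
            using cancel[of "f (v, False)"] by (simp add: F_def)
        next
          case False': False
          then have "(Suc k, v, False) \<notin> cells (int n)" "(k, v, True) \<notin> cells (int n)"
            by (auto simp: cells_def)
          with False show ?thesis by (simp add: i lookup_model_boundary ly)
        qed
      qed
    qed
    moreover have "\<phi> j y = f j" if "j \<in> J" for j
    proof -
      obtain v e where j: "j = (v, e)" by (cases j)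
      show ?thesis
      proof (cases e)
        case True
        then show ?thesis
          using that by (auto simp: j J_True \<phi>_def ly cells_def F_def)
      next
        case False
        have "P * s * (s * g' * z) + Q * (t' * z) = z" for z
          using arg_cong[OF PQ, of "\<lambda>x. x * z"]
          by (simp add: algebra_simps ss)
        note combination = this
        have "word_degree v \<le> n" using that False by (simp add: j J_False)
        then obtain i where deg: "n = i + word_degree v"
          by (metis le_add_diff_inverse2)
        have ly_F: "poly_mapping.lookup y (i, v, False) = F (i, v, False)"
          using deg by (simp add: ly cells_def)
        show ?thesis
        proof (cases "i = 0 \<or> odd i")
          case True
          with False show ?thesis by (auto simp: j \<phi>_def Let_def deg ly_F F_def)
        next
          case even: False
          then obtain i' where i': "i = Suc i'" "odd i'" by (cases i) auto
          have "poly_mapping.lookup y (i', v, True) = F (i', v, True)"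
            using deg i' by (simp add: ly cells_def)
          with False even i' show ?thesis
            using ly_F odd_pos[OF i'(2)] combination[of "f (v, False)"]
            by (simp add: j \<phi>_def Let_def deg F_def)
        qed
      qed
    qed
    ultimately show "\<exists>y. Poly_Mapping.keys y \<subseteq> cells (int n) \<and> model_boundary y = 0 \<and>
        (\<forall>j\<in>J. \<phi> j y = f j)"
      using y by blast
  next
    fix y assume y: "Poly_Mapping.keys y \<subseteq> cells (int n)" and cycle: "model_boundary y = 0"
    show "(\<exists>x. Poly_Mapping.keys x \<subseteq> cells (int n + 1) \<and> model_boundary x = y) \<longleftrightarrow>
      (\<forall>j\<in>J. \<mu> j dvd \<phi> j y)"
    proof
      assume "\<exists>x. Poly_Mapping.keys x \<subseteq> cells (int n + 1) \<and> model_boundary x = y"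
      then obtain x where x: "model_boundary x = y" by blast
      show "\<forall>j\<in>J. \<mu> j dvd \<phi> j y"
      proof
        fix j assume j: "j \<in> J"
        obtain v e where ve: "j = (v, e)" by (cases j)
        show "\<mu> j dvd \<phi> j y"
        proof (cases e)
          case True
          then show ?thesis
            by (simp add: ve \<phi>_def lookup_model_boundary flip: x)
        next
          case False
          define i where "i = n - word_degree v"
          have deg: "i + word_degree v = n" using j False by (simp add: ve J_False i_def)
          have "P * s * (s * g * z) + Q * (total * z) = \<gamma> * z" for z
            using arg_cong[OF PQ, of "\<lambda>x. \<gamma> * x * z"]
            by (simp add: algebra_simps ss g t)
          moreover have "\<gamma> dvd g" "\<gamma> dvd total" by (simp_all add: \<gamma>_def)
          moreover have "i = 0 \<longleftrightarrow> word_degree v = n" using deg by auto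
          ultimately show ?thesis
            using False deg
            by (auto simp: ve \<phi>_def Let_def lookup_model_boundary \<mu>_False s_def
                simp flip: x i_def intro!: dvd_add)
        qed
      qed
    next
      assume dvd: "\<forall>j\<in>J. \<mu> j dvd \<phi> j y"
      define C where "C v = \<phi> (v, False) y div \<mu> (v, False)" for v
      have C: "\<phi> (v, False) y = \<mu> (v, False) * C v" if "word_degree v \<le> n" for v
        using dvd that by (auto simp: C_def J_False)
      \<comment> \<open>In odd positions the quotient by \<open>\<gamma>\<close> is distributed by the Bezout coefficients.\<close>
      define F where "F i = (case i of (k, v, e) \<Rightarrow>
        if e then (if k = 0 then s * C v else if odd k then s * P * C v else C v)
        else Q * C v)" for i :: cell
      have "finite (cells (int n + 1))"
        using finite_cells[of "Suc n"] by (simp add: add.commute)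
      then obtain x where x: "Poly_Mapping.keys x \<subseteq> cells (int n + 1)"
        and lx: "\<And>i. poly_mapping.lookup x i = (if i \<in> cells (int n + 1) then F i else 0)"
        using ex_chain_with_coordinates by blast
      have cycle_at: "poly_mapping.lookup (model_boundary y) i = 0" for i
        using cycle by simp
      have "model_boundary x = y"
      proof (rule poly_mapping_eqI)
        fix i :: cell
        obtain k v e where i: "i = (k, v, e)" by (cases i)
        show "poly_mapping.lookup (model_boundary x) i = poly_mapping.lookup y i"
        proof (cases "i \<in> cells (int n)")
          case False
          have "Poly_Mapping.keys (model_boundary x) \<subseteq> cells (int n)"
            using keys_model_boundary[OF x] by simp
          then show ?thesis using lookup_eq_0[OF _ False] y by metis
        next
          case True
          \<comment> \<open>In even positions the cycle equation and the coordinate determine both entries.\<close>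
          have even_case: "poly_mapping.lookup y (Suc k, v, False) = s * g * C v \<and>
              poly_mapping.lookup y (k, v, True) = total * C v"
            if "odd k" "Suc (k + word_degree v) = n" for k v
          proof -
            let ?y1 = "poly_mapping.lookup y (Suc k, v, False)"
            let ?y2 = "poly_mapping.lookup y (k, v, True)"
            have n: "n - word_degree v = Suc k" "word_degree v \<le> n" "word_degree v \<noteq> n"
              using that by auto
            have "total * ?y1 - s * g * ?y2 = 0"
              using cycle_at[of "(k, v, False)"] that by (auto simp: lookup_model_boundary s_def)
            then have "\<gamma> * (t' * ?y1) = \<gamma> * (s * (g' * ?y2))"
              unfolding g t by (simp add: algebra_simps)
            then have slope: "t' * ?y1 = s * (g' * ?y2)"
              using \<gamma> by simp
            then have slope': "g' * ?y2 = s * (t' * ?y1)"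
              by (simp add: ss)
            have comb: "P * (s * ?y1) + Q * ?y2 = \<gamma> * C v"
              using C[OF n(2)] n that by (simp add: \<phi>_def Let_def \<mu>_False algebra_simps)
            have "?y1 = (P * g' + Q * t') * ?y1" using PQ by simp
            also have "\<dots> = s * g' * (P * (s * ?y1) + Q * ?y2)"
              using slope by (simp add: algebra_simps ss)
            finally have 1: "?y1 = s * g * C v" unfolding comb by (simp add: g)
            have "?y2 = (P * g' + Q * t') * ?y2" using PQ by simp
            also have "\<dots> = t' * (P * (s * ?y1) + Q * ?y2)"
              using slope'
              by (simp add: algebra_simps ss)
            finally have 2: "?y2 = total * C v" unfolding comb by (simp add: t)
            from 1 2 show ?thesis by blast
          qed
          show ?thesis
          proof (cases e)
            case e: False
            have deg: "k + word_degree v = n" using True by (simp add: i e cells_def)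
            show ?thesis
            proof (cases "k = 0 \<or> odd k")
              case True
              have n: "n - word_degree v = k" "word_degree v \<le> n" "word_degree v = n \<longleftrightarrow> k = 0"
                using deg by auto
              have "poly_mapping.lookup y (k, v, False) = (if k = 0 then g else \<gamma>) * C v"
                using C[OF n(2)] n True by (simp add: \<phi>_def Let_def \<mu>_False)
              moreover have "total * (Q * z) + s * g * (s * P * z) = \<gamma> * z" for z
                using arg_cong[OF PQ, of "\<lambda>x. \<gamma> * x * z"]
                by (simp add: algebra_simps ss g t)
              moreover have "s * g * (s * z) = g * z" for z
                by (simp add: algebra_simps ss)
              moreover have "(-1) ^ (k + word_degree v + 1) = s"
                using deg by (simp add: s_def)
              ultimately show ?thesis
                using True deg
                by (auto simp: i e lookup_model_boundary lx F_def cells_def)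
            next
              case False
              then obtain k' where k': "k = Suc k'" "odd k'" by (cases k) auto
              have "(-1) ^ (k + word_degree v + 1) = s"
                using deg by (simp add: s_def)
              then show ?thesis
                using even_case[of k' v] k' deg
                by (auto simp: i e lookup_model_boundary lx F_def cells_def)
            qed
          next
            case e: True
            have deg: "Suc (k + word_degree v) = n" using True by (simp add: i e cells_def)
            show ?thesis
            proof (cases "odd k")
              case True
              then show ?thesis
                using even_case[OF True deg] deg
                by (auto simp: i e lookup_model_boundary lx F_def cells_def)
            next
              case False
              have "g * poly_mapping.lookup y (k, v, True) = 0"
                using cycle_at[of "(k, v, False)"] False by (auto simp: lookup_model_boundary)
              moreover have "total * poly_mapping.lookup y (k, v, True) = 0" if "k \<noteq> 0"
                using cycle_at[of "(k - 1, v, True)"] False that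
                by (auto simp: lookup_model_boundary)
              moreover have "poly_mapping.lookup y (k, v, True) = 0" if "k = 0" "g = 0"
                using dvd[rule_format, of "(v, True)"] that deg
                by (simp add: J_True \<mu>_True \<phi>_def)
              ultimately have "poly_mapping.lookup y (k, v, True) = 0"
                using nonzero by auto
              then show ?thesis using False by (simp add: i e lookup_model_boundary)
            qed
          qed
        qed
      qed
      with x show "\<exists>x. Poly_Mapping.keys x \<subseteq> cells (int n + 1) \<and> model_boundary x = y"
        by blast
    qed
  qed
  then show ?thesis unfolding J_def \<mu>_def \<gamma>_def .
qed

lemma card_classes:
  "finite (g_classes n)" "finite (gcd_classes n)" "g_classes n \<inter> gcd_classes n = {}"
  "card (g_classes n) = (if g = 0 then 2 ^ n else r_seq n)"
  "card (gcd_classes n) = r_seq n - parity (n + 1)"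
proof -
  have fin: "finite {v. word_degree v + 1 = n}"
    by (rule finite_subset[OF _ finite_short_words[of n]]) (auto simp: short_words_def)
  show "finite (g_classes n)" "finite (gcd_classes n)"
    using fin by (simp_all add: g_classes_def gcd_classes_def)
  show "g_classes n \<inter> gcd_classes n = {}"
    by (auto simp: g_classes_def gcd_classes_def words_def short_words_def)
  have "card ((\<lambda>v. (v, False)) ` words n \<union> (\<lambda>v. (v, True)) ` {v. word_degree v + 1 = n}) =
      r_seq n + card {v. word_degree v + 1 = n}"
    using fin by (subst card_Un_disjoint) (auto simp: card_image inj_on_def card_words)
  then show "card (g_classes n) = (if g = 0 then 2 ^ n else r_seq n)"
    using card_words_pred[of n] by (auto simp: g_classes_def card_image inj_on_def card_words)
  show "card (gcd_classes n) = r_seq n - parity (n + 1)"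
    using card_short_words[of n] by (simp add: gcd_classes_def card_image inj_on_def)
qed

lemma rel_homology_power_product:
  assumes "g \<noteq> 0 \<or> total \<noteq> 0"
  shows "rel_homology_group a b c d False (int n) \<cong>
    group_power (Zmod g) (if g = 0 then 2 ^ n else r_seq n) \<times>\<times>
    group_power (Zmod (gcd g total)) (r_seq n - parity (n + 1))"
proof -
  let ?A = "\<lambda>j. Zmod (if j \<in> g_classes n then g else gcd g total)"
  note rel_homology_nonzero[OF assms, of n]
  also have "product_group (g_classes n \<union> gcd_classes n) ?A \<cong>
      product_group (g_classes n) ?A \<times>\<times> product_group (gcd_classes n) ?A"
    by (rule product_group_Un_iso[OF card_classes(3)])
  also have "product_group (g_classes n) ?A = product_group (g_classes n) (\<lambda>_. Zmod g)"
    by (rule product_group_cong) simp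
  also have "product_group (gcd_classes n) ?A = product_group (gcd_classes n) (\<lambda>_. Zmod (gcd g total))"
    by (rule product_group_cong) (use card_classes(3) in auto)
  also have "product_group (g_classes n) (\<lambda>_. Zmod g) \<times>\<times>
      product_group (gcd_classes n) (\<lambda>_. Zmod (gcd g total)) \<cong>
    group_power (Zmod g) (card (g_classes n)) \<times>\<times>
    group_power (Zmod (gcd g total)) (card (gcd_classes n))"
    by (rule group.DirProd_iso_trans) (simp_all add: product_group_iso_power card_classes(1,2))
  finally show ?thesis by (simp add: card_classes)
qed

lemma rel_homology_power:
  assumes "g \<noteq> 0" "total = 0"
  shows "rel_homology_group a b c d False (int n) \<cong>
    group_power (Zmod g) (2 * r_seq n - parity (n + 1))"
proof -
  have "Zmod (gcd g total) = Zmod g" using assms by (simp add: Zmod_def)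
  then have "rel_homology_group a b c d False (int n) \<cong>
      product_group (g_classes n \<union> gcd_classes n) (\<lambda>_. Zmod g)"
    using rel_homology_nonzero[of n] assms by (simp add: if_distrib[of Zmod] cong: if_cong)
  also have "\<dots> \<cong> group_power (Zmod g) (card (g_classes n \<union> gcd_classes n))"
    by (rule product_group_iso_power) (simp add: card_classes)
  also have "card (g_classes n \<union> gcd_classes n) = 2 * r_seq n - parity (n + 1)"
    using card_short_words[of n] assms by (simp add: card_Un_disjoint card_classes)
  finally show ?thesis .
qed

end

theorem proposition5p8:
  fixes a b c d g \<Sigma> :: int and n :: nat
  defines "g \<equiv> gcd (a + b) (a + c)"
    and "\<Sigma> \<equiv> a + b + c + d"
  defines "H \<equiv> rel_homology_group a b c d (bot :: bool) (int n)"
  shows "(\<Sigma> = 0 \<and> g = 0 \<longrightarrow> H \<cong> group_power integer_group (2 ^ (n + 1) - 1))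
       \<and> (\<Sigma> = 0 \<and> g \<noteq> 0 \<longrightarrow> H \<cong> group_power (Zmod g) (2 * r_seq n - parity (n + 1)))
       \<and> (\<Sigma> \<noteq> 0 \<and> g = 0 \<longrightarrow>
            H \<cong> group_power integer_group (2 ^ n) \<times>\<times>
                group_power (Zmod \<Sigma>) (r_seq n - parity (n + 1)))
       \<and> (\<Sigma> \<noteq> 0 \<and> g \<noteq> 0 \<longrightarrow>
            H \<cong> group_power (Zmod g) (r_seq n) \<times>\<times>
                group_power (Zmod (gcd g \<Sigma>)) (r_seq n - parity (n + 1)))"
proof -
  \<comment> \<open>For \<open>g = 0\<close> all weights vanish and any basis of \<open>V\<close> will do.\<close>
  obtain \<alpha> \<beta> p q where "four_term_scalars a b c g \<alpha> \<beta> p q"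
  proof (cases "g = 0")
    case True
    then have "a + b = 0" "a + c = 0" by (auto simp: g_def)
    then show ?thesis
      using that[of 1 0 1 0] True by (simp add: four_term_scalars_def)
  next
    case False
    obtain p q where "p * (a + b) + q * (a + c) = g"
      unfolding g_def using bezout_int by blast
    moreover have ab: "a + b = g * ((a + b) div g)" and ac: "a + c = g * ((a + c) div g)"
      by (simp_all add: g_def)
    moreover have "g * (p * ((a + b) div g) + q * ((a + c) div g)) =
        p * (g * ((a + b) div g)) + q * (g * ((a + c) div g))"
      by (simp add: algebra_simps)
    ultimately have "g * (p * ((a + b) div g) + q * ((a + c) div g)) = g * 1"
      by (simp flip: ab ac)
    then have "p * ((a + b) div g) + q * ((a + c) div g) = 1"
      using False by simp
    with ab ac show ?thesis
      using that unfolding four_term_scalars_def by blast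
  qed
  then interpret four_term_scalars a b c d g \<alpha> \<beta> p q .
  have total: "total = \<Sigma>" by (simp add: total_def \<Sigma>_def)
  have H: "H = rel_homology_group a b c d False (int n)"
    by (simp add: H_def)
  have Z: "Zmod 0 = integer_group" by (simp add: Zmod_def integer_mod_group_def)
  have Zabs: "Zmod \<bar>m\<bar> = Zmod m" for m by (simp add: Zmod_def)
  have "H \<cong> group_power integer_group (2 ^ (n + 1) - 1)" if "\<Sigma> = 0" "g = 0"
    using iso_trans[OF rel_homology_all_zero product_group_iso_power[OF finite_cells]] that
    unfolding H total card_cells Z by blast
  moreover have "H \<cong> group_power (Zmod g) (2 * r_seq n - parity (n + 1))" if "\<Sigma> = 0" "g \<noteq> 0"
    using rel_homology_power that unfolding H total by blast
  ultimately show ?thesis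
    using rel_homology_power_product[of n] unfolding H total by (auto simp: Z Zabs)
qed

end
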